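(* Let $q_{\mathscr E}\colon\mathscr E\to T$ be a Fell-bundle equivalence between the Fell bundles $p_{\mathscr B}\colon\mathscr B\to H$ and $p_{\mathscr C}\colon\mathscr C\to K$. Let $\mathscr J$ be an ideal in $\mathscr C$, and let $\mathscr M$ and $\mathscr K$ be the corresponding full Banach $\mathscr B$–$\mathscr C$-submodule of $\mathscr E$ and the corresponding ideal in $\mathscr B$. Then $\mathscr M$ (with the restricted actions and inner products) is a Fell-bundle equivalence between $\mathscr K$ and $\mathscr J$.
   Context: **Conventions.** Locally compact means locally compact Hausdorff; all groupoids are second countable, locally compact and Hausdorff, with unit space $G^{(0)}$, range map $r$, source map $s$. Ideals in $C^*$-algebras are two-sided and norm closed. Products and inner products of sets denote linear spans: $S\cdot Y=\operatorname{span}\{a\cdot x: a\in S, x\in Y\}$ and $\langle Y_1,Y_2\rangle=\operatorname{span}\{\langle x,y\rangle: x\in Y_1,y\in Y_2\}$. (If $X$ is a right Hilbert $B$-module and $J$ an ideal of $B$, then $X\cdot J=\{x\cdot b:x\in X,b\in J\}$ is already closed; similarly on the left.) Closures of subsets of fibres are in the fibre norm. **Banach bundles.** A Banach bundle over a topological space $X$ is a topological space $\mathscr B$ with a continuous open surjection $p\colon\mathscr B\to X$ and complex Banach space structures on the fibres $B_x=p^{-1}(\{x\})$ such that: (B1) $b\mapsto\|b\|$ is upper semicontinuous; (B2) addition is continuous on $\{(a,b):p(a)=p(b)\}$; (B3) $(\lambda,b)\mapsto\lambda b$ is continuous on $\mathbf C\times\mathscr B$; (B4) if $p(b_i)\to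 x$ and $\|b_i\|\to0$ then $b_i\to0_x$. A Banach subbundle $\mathscr D\subset\mathscr B$ is a subset whose fibres $D_x=\mathscr D\cap B_x$ are closed subspaces of $B_x$ and such that $p|_{\mathscr D}\colon\mathscr D\to X$ is a Banach bundle with the relative topology. **Fell bundles.** A Fell bundle over a groupoid $G$ is a Banach bundle $p\colon\mathscr B\to G$ with a continuous, bilinear, associative multiplication $(a,b)\mapsto ab$ from $\mathscr B^{(2)}=\{(a,b):(p(a),p(b))\in G^{(2)}\}$ to $\mathscr B$ and a continuous involution $b\mapsto b^*$ such that $p(ab)=p(a)p(b)$, $p(a^* )=p(a)^{-1}$, $(ab)^*=b^*a^*$, each $B_u$ ($u\in G^{(0)}$) is a $C^*$-algebra in the inherited operations, and each $B_g$ is a $B_{r(g)}$–$B_{s(g)}$-imprimitivity bimodule with the inherited actions and inner products ${}_{B_{r(g)}}\langle a,b\rangle=ab^*$, $\langle a,b\rangle_{B_{s(g)}}=a^*b$. A Fell subbundle is a Banach subbundle that is a Fell bundle in the inherited operations. An ideal $\mathscr J$ of $\mathscr B$ is a Fell subbundle such that $ab\in\mathscr J$ whenever $(a,b)\in\mathscr B^{(2)}$ and $a\in\mathscr J$ or $b\in\mathscr J$. Its fibres are $J_g=\mathscr J\cap B_g$. **Groupoid equivalences.** An $(H,K)$-equivalence $T$ is a locally compact Hausdorff space that is a free and proper left $H$-space and a free and proper right $K$-space, with commuting actions and open moment maps $\rho\colon T\to H^{(0)}$, $\sigma\colon T\to K^{(0)}$ inducing homeomorphisms $T/K\cong H^{(0)}$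 and $H\backslash T\cong K^{(0)}$. There are continuous maps $\tau_H\colon T*_\sigma T\to H$ and $\tau_K\colon T*_\rho T\to K$ with $\tau_H(t,t')\cdot t'=t$ and $t\cdot\tau_K(t,t')=t'$. **Actions and Fell-bundle equivalences.** A Fell bundle $p\colon\mathscr B\to H$ acts on the left of a Banach bundle $q\colon\mathscr E\to T$ if there is a continuous map $(b,e)\mapsto b\cdot e$ from $\{(b,e): s(p(b))=\rho(q(e))\}$ to $\mathscr E$ with $q(b\cdot e)=p(b)\cdot q(e)$, $a\cdot(b\cdot e)=(ab)\cdot e$, and $\|b\cdot e\|\le\|b\|\|e\|$; right actions are similar. For Fell bundles $p_{\mathscr B}\colon\mathscr B\to H$, $p_{\mathscr C}\colon\mathscr C\to K$ and an $(H,K)$-equivalence $T$, a Banach bundle $q_{\mathscr E}\colon\mathscr E\to T$ is an equivalence between $\mathscr B$ and $\mathscr C$ if: (E1) there are a left $\mathscr B$-action and a right $\mathscr C$-action on $\mathscr E$ with $b\cdot(e\cdot c)=(b\cdot e)\cdot c$; (E2) there are continuous sesquilinear maps ${}_{\mathscr B}\langle\cdot,\cdot\rangle\colon\mathscr E*_\sigma\mathscr E\to\mathscr B$ and $\langle\cdot,\cdot\rangle_{\mathscr C}\colon\mathscr E*_\rho\mathscr E\to\mathscr C$ (defined on pairs whose base points have equal $\sigma$, resp. $\rho$) with (i) $p_{\mathscr B}({}_{\mathscr B}\langle e,f\rangle)=\tau_H(q(e),q(f))$, $p_{\mathscr C}(\langle e,f\rangle_{\mathscr C})=\tau_K(q(e),q(f))$;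 (ii) ${}_{\mathscr B}\langle e,f\rangle^*={}_{\mathscr B}\langle f,e\rangle$, $\langle e,f\rangle_{\mathscr C}^*=\langle f,e\rangle_{\mathscr C}$; (iii) ${}_{\mathscr B}\langle b\cdot e,f\rangle=b\,{}_{\mathscr B}\langle e,f\rangle$, $\langle e,f\cdot c\rangle_{\mathscr C}=\langle e,f\rangle_{\mathscr C}c$; (iv) ${}_{\mathscr B}\langle e,f\rangle\cdot g=e\cdot\langle f,g\rangle_{\mathscr C}$; (E3) with these actions and inner products each fibre $E_t$ is a $B_{\rho(t)}$–$C_{\sigma(t)}$-imprimitivity bimodule. **Submodules.** A Banach $\mathscr B$–$\mathscr C$-submodule of $\mathscr E$ is a Banach subbundle $\mathscr M$ of $\mathscr E$ with $B_h\cdot M_t\subset M_{h\cdot t}$ whenever $s(h)=\rho(t)$ and $M_t\cdot C_k\subset M_{t\cdot k}$ whenever $\sigma(t)=r(k)$. It is full if $\overline{B_h\cdot M_t}=M_{h\cdot t}$ and $\overline{M_t\cdot C_k}=M_{t\cdot k}$ for all such $h,t,k$. **The correspondence.** The maps $\mathscr J\mapsto\mathscr E\cdot\mathscr J=\bigcup_{t\in T}E_t\cdot J_{\sigma(t)}$ and $\mathscr K\mapsto\mathscr K\cdot\mathscr E=\bigcup_{t\in T}K_{\rho(t)}\cdot E_t$ are lattice isomorphisms from the ideals of $\mathscr C$, respectively of $\mathscr B$, onto the full Banach $\mathscr B$–$\mathscr C$-submodules of $\mathscr E$. Thus for an ideal $\mathscr J$ of $\mathscr C$, the corresponding submodule is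 $\mathscr M=\mathscr E\cdot\mathscr J$ and the corresponding ideal of $\mathscr B$ is the unique ideal $\mathscr K$ with $\mathscr K\cdot\mathscr E=\mathscr M$. *)

theory Defs
  imports "HOL-Analysis.Analysis"
begin

section \<open>Complex Banach spaces and C*-algebras on a carrier\<close>

record 'a cspace =
  carr  :: "'a set"
  vadd  :: "'a \<Rightarrow> 'a \<Rightarrow> 'a"
  vzero :: 'a
  vsc   :: "complex \<Rightarrow> 'a \<Rightarrow> 'a"
  vnorm :: "'a \<Rightarrow> real"

text \<open>The value off the carrier is irrelevant; it is fixed to 0 because the library locale
  \<^locale>\<open>Metric_space\<close> asks for nonnegativity and symmetry on the whole type.\<close>
definition vdist :: "('a, 'z) cspace_scheme \<Rightarrow> 'a \<Rightarrow> 'a \<Rightarrow> real" where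
  "vdist V a b =
     (if a \<in> carr V \<and> b \<in> carr V then vnorm V (vadd V a (vsc V (-1) b)) else 0)"

definition norm_topology :: "('a, 'z) cspace_scheme \<Rightarrow> 'a topology" where
  "norm_topology V = Metric_space.mtopology (carr V) (vdist V)"

inductive_set lin_span :: "('a, 'z) cspace_scheme \<Rightarrow> 'a set \<Rightarrow> 'a set"
  for V :: "('a, 'z) cspace_scheme" and S :: "'a set" where
  zero: "vzero V \<in> lin_span V S"
| base: "a \<in> S \<Longrightarrow> a \<in> lin_span V S"
| add: "a \<in> lin_span V S \<Longrightarrow> b \<in> lin_span V S \<Longrightarrow> vadd V a b \<in> lin_span V S"
| scale: "a \<in> lin_span V S \<Longrightarrow> vsc V c a \<in> lin_span V S"

locale complex_banach =
  fixes V :: "('a, 'z) cspace_scheme"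
  assumes zero_closed: "vzero V \<in> carr V"
    and add_closed: "\<lbrakk>a \<in> carr V; b \<in> carr V\<rbrakk> \<Longrightarrow> vadd V a b \<in> carr V"
    and sc_closed: "a \<in> carr V \<Longrightarrow> vsc V c a \<in> carr V"
    and add_assoc: "\<lbrakk>a \<in> carr V; b \<in> carr V; d \<in> carr V\<rbrakk>
          \<Longrightarrow> vadd V (vadd V a b) d = vadd V a (vadd V b d)"
    and add_commute: "\<lbrakk>a \<in> carr V; b \<in> carr V\<rbrakk> \<Longrightarrow> vadd V a b = vadd V b a"
    and add_zero: "a \<in> carr V \<Longrightarrow> vadd V a (vzero V) = a"
    and add_minus: "a \<in> carr V \<Longrightarrow> vadd V a (vsc V (-1) a) = vzero V"
    and sc_one: "a \<in> carr V \<Longrightarrow> vsc V 1 a = a"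
    and sc_sc: "a \<in> carr V \<Longrightarrow> vsc V c (vsc V c' a) = vsc V (c * c') a"
    and sc_add: "\<lbrakk>a \<in> carr V; b \<in> carr V\<rbrakk>
          \<Longrightarrow> vsc V c (vadd V a b) = vadd V (vsc V c a) (vsc V c b)"
    and add_sc: "a \<in> carr V \<Longrightarrow> vsc V (c + c') a = vadd V (vsc V c a) (vsc V c' a)"
    and norm_nonneg: "a \<in> carr V \<Longrightarrow> 0 \<le> vnorm V a"
    and norm_eq_zero: "a \<in> carr V \<Longrightarrow> vnorm V a = 0 \<longleftrightarrow> a = vzero V"
    and norm_sc: "a \<in> carr V \<Longrightarrow> vnorm V (vsc V c a) = cmod c * vnorm V a"
    and norm_triangle: "\<lbrakk>a \<in> carr V; b \<in> carr V\<rbrakk>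
          \<Longrightarrow> vnorm V (vadd V a b) \<le> vnorm V a + vnorm V b"
    and complete: "Metric_space.mcomplete (carr V) (vdist V)"

definition closed_subspace :: "('a, 'z) cspace_scheme \<Rightarrow> 'a set \<Rightarrow> bool" where
  "closed_subspace V W \<longleftrightarrow>
     vzero V \<in> W \<and> (\<forall>a\<in>W. \<forall>b\<in>W. vadd V a b \<in> W) \<and> (\<forall>c. \<forall>a\<in>W. vsc V c a \<in> W) \<and>
     closedin (norm_topology V) W"

record 'a calg = "'a cspace" +
  amul  :: "'a \<Rightarrow> 'a \<Rightarrow> 'a"
  astar :: "'a \<Rightarrow> 'a"

locale cstar_algebra = complex_banach A for A :: "('a, 'z) calg_scheme" +
  assumes mul_closed: "\<lbrakk>a \<in> carr A; b \<in> carr A\<rbrakk> \<Longrightarrow> amul A a b \<in> carr A"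
    and mul_assoc: "\<lbrakk>a \<in> carr A; b \<in> carr A; d \<in> carr A\<rbrakk>
          \<Longrightarrow> amul A (amul A a b) d = amul A a (amul A b d)"
    and mul_add_left: "\<lbrakk>a \<in> carr A; b \<in> carr A; d \<in> carr A\<rbrakk>
          \<Longrightarrow> amul A (vadd A a b) d = vadd A (amul A a d) (amul A b d)"
    and mul_add_right: "\<lbrakk>a \<in> carr A; b \<in> carr A; d \<in> carr A\<rbrakk>
          \<Longrightarrow> amul A a (vadd A b d) = vadd A (amul A a b) (amul A a d)"
    and mul_sc_left: "\<lbrakk>a \<in> carr A; b \<in> carr A\<rbrakk> \<Longrightarrow> amul A (vsc A c a) b = vsc A c (amul A a b)"
    and mul_sc_right: "\<lbrakk>a \<in> carr A; b \<in> carr A\<rbrakk> \<Longrightarrow> amul A a (vsc A c b) = vsc A c (amul A a b)"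
    and star_closed: "a \<in> carr A \<Longrightarrow> astar A a \<in> carr A"
    and star_star: "a \<in> carr A \<Longrightarrow> astar A (astar A a) = a"
    and star_add: "\<lbrakk>a \<in> carr A; b \<in> carr A\<rbrakk>
          \<Longrightarrow> astar A (vadd A a b) = vadd A (astar A a) (astar A b)"
    and star_sc: "a \<in> carr A \<Longrightarrow> astar A (vsc A c a) = vsc A (cnj c) (astar A a)"
    and star_mul: "\<lbrakk>a \<in> carr A; b \<in> carr A\<rbrakk>
          \<Longrightarrow> astar A (amul A a b) = amul A (astar A b) (astar A a)"
    and norm_mul: "\<lbrakk>a \<in> carr A; b \<in> carr A\<rbrakk> \<Longrightarrow> vnorm A (amul A a b) \<le> vnorm A a * vnorm A b"
    and cstar_identity: "a \<in> carr A \<Longrightarrow> vnorm A (amul A (astar A a) a) = (vnorm A a)\<^sup>2"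

text \<open>The spectrum, computed in the unitization \<open>A \<oplus> \<complex>\<close>: the element \<open>z - a\<close> is invertible there
  iff it has a two-sided inverse \<open>b + w\<close>, i.e. \<open>z w = 1\<close> and \<open>z b - w a - a b = 0 = z b - w a - b a\<close>.
  If \<open>A\<close> is unital this differs from the spectrum in \<open>A\<close> at most by the point 0, which is
  immaterial for positivity.\<close>
definition spectrum :: "('a, 'z) calg_scheme \<Rightarrow> 'a \<Rightarrow> complex set" where
  "spectrum A a = {z. \<not> (\<exists>b\<in>carr A. \<exists>w. z * w = 1 \<and>
      vsc A z b = vadd A (vsc A w a) (amul A a b) \<and>
      vsc A z b = vadd A (vsc A w a) (amul A b a))}"

definition positive_elt :: "('a, 'z) calg_scheme \<Rightarrow> 'a \<Rightarrow> bool" where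
  "positive_elt A a \<longleftrightarrow>
     a \<in> carr A \<and> astar A a = a \<and> spectrum A a \<subseteq> {z. \<exists>x\<ge>0. z = complex_of_real x}"

section \<open>Imprimitivity bimodules\<close>

text \<open>Full right Hilbert modules. The given norm of \<open>X\<close> is required to be the one induced by the
  inner product, so that completeness in the latter is \<^locale>\<open>complex_banach\<close>.\<close>
locale full_right_hilbert_module = A: cstar_algebra A + X: complex_banach X
  for A :: "'a calg" and X :: "'x cspace" +
  fixes act :: "'x \<Rightarrow> 'a \<Rightarrow> 'x" and ip :: "'x \<Rightarrow> 'x \<Rightarrow> 'a"
  assumes act_closed: "\<lbrakk>x \<in> carr X; a \<in> carr A\<rbrakk> \<Longrightarrow> act x a \<in> carr X"
    and act_add_left: "\<lbrakk>x \<in> carr X; y \<in> carr X; a \<in> carr A\<rbrakk>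
          \<Longrightarrow> act (vadd X x y) a = vadd X (act x a) (act y a)"
    and act_add_right: "\<lbrakk>x \<in> carr X; a \<in> carr A; b \<in> carr A\<rbrakk>
          \<Longrightarrow> act x (vadd A a b) = vadd X (act x a) (act x b)"
    and act_sc_left: "\<lbrakk>x \<in> carr X; a \<in> carr A\<rbrakk> \<Longrightarrow> act (vsc X c x) a = vsc X c (act x a)"
    and act_sc_right: "\<lbrakk>x \<in> carr X; a \<in> carr A\<rbrakk> \<Longrightarrow> act x (vsc A c a) = vsc X c (act x a)"
    and act_mul: "\<lbrakk>x \<in> carr X; a \<in> carr A; b \<in> carr A\<rbrakk> \<Longrightarrow> act x (amul A a b) = act (act x a) b"
    and ip_closed: "\<lbrakk>x \<in> carr X; y \<in> carr X\<rbrakk> \<Longrightarrow> ip x y \<in> carr A"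
    and ip_add: "\<lbrakk>x \<in> carr X; y \<in> carr X; z \<in> carr X\<rbrakk>
          \<Longrightarrow> ip x (vadd X y z) = vadd A (ip x y) (ip x z)"
    and ip_sc: "\<lbrakk>x \<in> carr X; y \<in> carr X\<rbrakk> \<Longrightarrow> ip x (vsc X c y) = vsc A c (ip x y)"
    and ip_act: "\<lbrakk>x \<in> carr X; y \<in> carr X; a \<in> carr A\<rbrakk> \<Longrightarrow> ip x (act y a) = amul A (ip x y) a"
    and ip_star: "\<lbrakk>x \<in> carr X; y \<in> carr X\<rbrakk> \<Longrightarrow> astar A (ip x y) = ip y x"
    and ip_pos: "x \<in> carr X \<Longrightarrow> positive_elt A (ip x x)"
    and ip_definite: "\<lbrakk>x \<in> carr X; ip x x = vzero A\<rbrakk> \<Longrightarrow> x = vzero X"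
    and ip_norm: "x \<in> carr X \<Longrightarrow> (vnorm X x)\<^sup>2 = vnorm A (ip x x)"
    and ip_full: "norm_topology A closure_of
          lin_span A {ip x y | x y. x \<in> carr X \<and> y \<in> carr X} = carr A"

locale full_left_hilbert_module = A: cstar_algebra A + X: complex_banach X
  for A :: "'a calg" and X :: "'x cspace" +
  fixes act :: "'a \<Rightarrow> 'x \<Rightarrow> 'x" and ip :: "'x \<Rightarrow> 'x \<Rightarrow> 'a"
  assumes act_closed: "\<lbrakk>a \<in> carr A; x \<in> carr X\<rbrakk> \<Longrightarrow> act a x \<in> carr X"
    and act_add_left: "\<lbrakk>a \<in> carr A; b \<in> carr A; x \<in> carr X\<rbrakk>
          \<Longrightarrow> act (vadd A a b) x = vadd X (act a x) (act b x)"
    and act_add_right: "\<lbrakk>a \<in> carr A; x \<in> carr X; y \<in> carr X\<rbrakk>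
          \<Longrightarrow> act a (vadd X x y) = vadd X (act a x) (act a y)"
    and act_sc_left: "\<lbrakk>a \<in> carr A; x \<in> carr X\<rbrakk> \<Longrightarrow> act (vsc A c a) x = vsc X c (act a x)"
    and act_sc_right: "\<lbrakk>a \<in> carr A; x \<in> carr X\<rbrakk> \<Longrightarrow> act a (vsc X c x) = vsc X c (act a x)"
    and act_mul: "\<lbrakk>a \<in> carr A; b \<in> carr A; x \<in> carr X\<rbrakk> \<Longrightarrow> act (amul A a b) x = act a (act b x)"
    and ip_closed: "\<lbrakk>x \<in> carr X; y \<in> carr X\<rbrakk> \<Longrightarrow> ip x y \<in> carr A"
    and ip_add: "\<lbrakk>x \<in> carr X; y \<in> carr X; z \<in> carr X\<rbrakk>
          \<Longrightarrow> ip (vadd X x y) z = vadd A (ip x z) (ip y z)"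
    and ip_sc: "\<lbrakk>x \<in> carr X; y \<in> carr X\<rbrakk> \<Longrightarrow> ip (vsc X c x) y = vsc A c (ip x y)"
    and ip_act: "\<lbrakk>a \<in> carr A; x \<in> carr X; y \<in> carr X\<rbrakk> \<Longrightarrow> ip (act a x) y = amul A a (ip x y)"
    and ip_star: "\<lbrakk>x \<in> carr X; y \<in> carr X\<rbrakk> \<Longrightarrow> astar A (ip x y) = ip y x"
    and ip_pos: "x \<in> carr X \<Longrightarrow> positive_elt A (ip x x)"
    and ip_definite: "\<lbrakk>x \<in> carr X; ip x x = vzero A\<rbrakk> \<Longrightarrow> x = vzero X"
    and ip_norm: "x \<in> carr X \<Longrightarrow> (vnorm X x)\<^sup>2 = vnorm A (ip x x)"
    and ip_full: "norm_topology A closure_of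
          lin_span A {ip x y | x y. x \<in> carr X \<and> y \<in> carr X} = carr A"

locale imprimitivity_bimodule =
  L: full_left_hilbert_module A X lact lip + R: full_right_hilbert_module B X ract rip
  for A :: "'a calg" and B :: "'b calg" and X :: "'x cspace"
    and lact :: "'a \<Rightarrow> 'x \<Rightarrow> 'x" and ract :: "'x \<Rightarrow> 'b \<Rightarrow> 'x"
    and lip :: "'x \<Rightarrow> 'x \<Rightarrow> 'a" and rip :: "'x \<Rightarrow> 'x \<Rightarrow> 'b" +
  assumes bimodule: "\<lbrakk>a \<in> carr A; x \<in> carr X; b \<in> carr B\<rbrakk>
          \<Longrightarrow> ract (lact a x) b = lact a (ract x b)"
    and left_adjoint: "\<lbrakk>a \<in> carr A; x \<in> carr X; y \<in> carr X\<rbrakk>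
          \<Longrightarrow> rip (lact a x) y = rip x (lact (astar A a) y)"
    and right_adjoint: "\<lbrakk>b \<in> carr B; x \<in> carr X; y \<in> carr X\<rbrakk>
          \<Longrightarrow> lip (ract x b) y = lip x (ract y (astar B b))"
    and ip_compat: "\<lbrakk>x \<in> carr X; y \<in> carr X; z \<in> carr X\<rbrakk>
          \<Longrightarrow> lact (lip x y) z = ract x (rip y z)"

section \<open>Banach bundles\<close>

record ('b, 'x) bundle_data =
  btop  :: "'b topology"
  proj  :: "'b \<Rightarrow> 'x"
  badd  :: "'b \<Rightarrow> 'b \<Rightarrow> 'b"
  bzero :: "'x \<Rightarrow> 'b"
  bsc   :: "complex \<Rightarrow> 'b \<Rightarrow> 'b"
  bnorm :: "'b \<Rightarrow> real"

definition fib :: "('b, 'x, 'z) bundle_data_scheme \<Rightarrow> 'x \<Rightarrow> 'b set" where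
  "fib \<B> x = {b \<in> topspace (btop \<B>). proj \<B> b = x}"

definition fibre :: "('b, 'x, 'z) bundle_data_scheme \<Rightarrow> 'x \<Rightarrow> 'b cspace" where
  "fibre \<B> x = \<lparr>carr = fib \<B> x, vadd = badd \<B>, vzero = bzero \<B> x, vsc = bsc \<B>, vnorm = bnorm \<B>\<rparr>"

text \<open>In \<open>lim_zero\<close> the nets \<open>(b\<^sub>i)\<close> of the usual axiom (B4) are replaced by the filters they
  generate on the total space.\<close>
locale banach_bundle =
  fixes X :: "'x topology" and \<B> :: "('b, 'x, 'z) bundle_data_scheme"
  assumes proj_continuous: "continuous_map (btop \<B>) X (proj \<B>)"
    and proj_open: "open_map (btop \<B>) X (proj \<B>)"
    and proj_surj: "proj \<B> ` topspace (btop \<B>) = topspace X"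
    and fibre_banach: "x \<in> topspace X \<Longrightarrow> complex_banach (fibre \<B> x)"
    and norm_usc: "openin (btop \<B>) {b \<in> topspace (btop \<B>). bnorm \<B> b < c}"
    and add_continuous: "continuous_map
          (subtopology (prod_topology (btop \<B>) (btop \<B>)) {(a, b). proj \<B> a = proj \<B> b})
          (btop \<B>) (\<lambda>(a, b). badd \<B> a b)"
    and sc_continuous: "continuous_map
          (prod_topology euclidean (btop \<B>)) (btop \<B>) (\<lambda>(c, b). bsc \<B> c b)"
    and lim_zero: "\<And>x F. \<lbrakk>x \<in> topspace X; eventually (\<lambda>b. b \<in> topspace (btop \<B>)) F;
          limitin X (proj \<B>) x F; (bnorm \<B> \<longlongrightarrow> 0) F\<rbrakk>
          \<Longrightarrow> limitin (btop \<B>) (\<lambda>b. b) (bzero \<B> x) F"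

text \<open>Restriction to a subset of the total space; all operations of the (possibly extended) record
  are inherited, and continuity into the relative topology makes the subset closed under them.\<close>
definition restrict_bundle ::
    "('b, 'x, 'z) bundle_data_scheme \<Rightarrow> 'b set \<Rightarrow> ('b, 'x, 'z) bundle_data_scheme" (infixl "\<restriction>\<^sub>b" 80) where
  "\<B> \<restriction>\<^sub>b \<D> = \<B>\<lparr>btop := subtopology (btop \<B>) \<D>\<rparr>"

definition banach_subbundle :: "'x topology \<Rightarrow> ('b, 'x, 'z) bundle_data_scheme \<Rightarrow> 'b set \<Rightarrow> bool" where
  "banach_subbundle X \<B> \<D> \<longleftrightarrow>
     \<D> \<subseteq> topspace (btop \<B>) \<and>
     (\<forall>x\<in>topspace X. closed_subspace (fibre \<B> x) (\<D> \<inter> fib \<B> x)) \<and>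
     banach_bundle X (\<B> \<restriction>\<^sub>b \<D>)"

section \<open>Groupoids and groupoid equivalences\<close>

record 'g groupoid_data =
  gtop :: "'g topology"
  rng  :: "'g \<Rightarrow> 'g"
  src  :: "'g \<Rightarrow> 'g"
  gmul :: "'g \<Rightarrow> 'g \<Rightarrow> 'g"
  ginv :: "'g \<Rightarrow> 'g"

abbreviation arrows :: "('g, 'z) groupoid_data_scheme \<Rightarrow> 'g set" where
  "arrows G \<equiv> topspace (gtop G)"

definition units :: "('g, 'z) groupoid_data_scheme \<Rightarrow> 'g set" where
  "units G = src G ` arrows G"

locale lch_groupoid =
  fixes G :: "('g, 'z) groupoid_data_scheme"
  assumes src_closed: "g \<in> arrows G \<Longrightarrow> src G g \<in> arrows G"
    and rng_closed: "g \<in> arrows G \<Longrightarrow> rng G g \<in> arrows G"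
    and inv_closed: "g \<in> arrows G \<Longrightarrow> ginv G g \<in> arrows G"
    and mul_closed: "\<lbrakk>g \<in> arrows G; h \<in> arrows G; src G g = rng G h\<rbrakk> \<Longrightarrow> gmul G g h \<in> arrows G"
    and src_src: "g \<in> arrows G \<Longrightarrow> src G (src G g) = src G g"
    and rng_src: "g \<in> arrows G \<Longrightarrow> rng G (src G g) = src G g"
    and src_rng: "g \<in> arrows G \<Longrightarrow> src G (rng G g) = rng G g"
    and rng_rng: "g \<in> arrows G \<Longrightarrow> rng G (rng G g) = rng G g"
    and rng_mul: "\<lbrakk>g \<in> arrows G; h \<in> arrows G; src G g = rng G h\<rbrakk> \<Longrightarrow> rng G (gmul G g h) = rng G g"
    and src_mul: "\<lbrakk>g \<in> arrows G; h \<in> arrows G; src G g = rng G h\<rbrakk> \<Longrightarrow> src G (gmul G g h) = src G h"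
    and mul_assoc: "\<lbrakk>g \<in> arrows G; h \<in> arrows G; k \<in> arrows G; src G g = rng G h; src G h = rng G k\<rbrakk>
          \<Longrightarrow> gmul G (gmul G g h) k = gmul G g (gmul G h k)"
    and mul_src: "g \<in> arrows G \<Longrightarrow> gmul G g (src G g) = g"
    and rng_mul_self: "g \<in> arrows G \<Longrightarrow> gmul G (rng G g) g = g"
    and rng_inv: "g \<in> arrows G \<Longrightarrow> rng G (ginv G g) = src G g"
    and src_inv: "g \<in> arrows G \<Longrightarrow> src G (ginv G g) = rng G g"
    and inv_mul: "g \<in> arrows G \<Longrightarrow> gmul G (ginv G g) g = src G g"
    and mul_inv: "g \<in> arrows G \<Longrightarrow> gmul G g (ginv G g) = rng G g"
    and mul_continuous: "continuous_map
          (subtopology (prod_topology (gtop G) (gtop G)) {(g, h). src G g = rng G h})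
          (gtop G) (\<lambda>(g, h). gmul G g h)"
    and inv_continuous: "continuous_map (gtop G) (gtop G) (ginv G)"
    and second_countable: "second_countable (gtop G)"
    and locally_compact: "locally_compact_space (gtop G)"
    and Hausdorff: "Hausdorff_space (gtop G)"

locale free_proper_left_space = lch_groupoid G
  for G :: "('g, 'z) groupoid_data_scheme" +
  fixes X :: "'x topology" and mom :: "'x \<Rightarrow> 'g" and act :: "'g \<Rightarrow> 'x \<Rightarrow> 'x"
  assumes mom_continuous: "continuous_map X (subtopology (gtop G) (units G)) mom"
    and act_continuous: "continuous_map
          (subtopology (prod_topology (gtop G) X) {(g, x). src G g = mom x}) X (\<lambda>(g, x). act g x)"
    and mom_act: "\<lbrakk>g \<in> arrows G; x \<in> topspace X; src G g = mom x\<rbrakk> \<Longrightarrow> mom (act g x) = rng G g"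
    and act_unit: "x \<in> topspace X \<Longrightarrow> act (mom x) x = x"
    and act_mul: "\<lbrakk>g \<in> arrows G; h \<in> arrows G; x \<in> topspace X; src G g = rng G h; src G h = mom x\<rbrakk>
          \<Longrightarrow> act (gmul G g h) x = act g (act h x)"
    and free: "\<lbrakk>g \<in> arrows G; x \<in> topspace X; src G g = mom x; act g x = x\<rbrakk> \<Longrightarrow> g \<in> units G"
    and proper: "proper_map
          (subtopology (prod_topology (gtop G) X) {(g, x). src G g = mom x})
          (prod_topology X X) (\<lambda>(g, x). (act g x, x))"

locale free_proper_right_space = lch_groupoid G
  for G :: "('g, 'z) groupoid_data_scheme" +
  fixes X :: "'x topology" and mom :: "'x \<Rightarrow> 'g" and act :: "'x \<Rightarrow> 'g \<Rightarrow> 'x"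
  assumes mom_continuous: "continuous_map X (subtopology (gtop G) (units G)) mom"
    and act_continuous: "continuous_map
          (subtopology (prod_topology X (gtop G)) {(x, g). mom x = rng G g}) X (\<lambda>(x, g). act x g)"
    and mom_act: "\<lbrakk>x \<in> topspace X; g \<in> arrows G; mom x = rng G g\<rbrakk> \<Longrightarrow> mom (act x g) = src G g"
    and act_unit: "x \<in> topspace X \<Longrightarrow> act x (mom x) = x"
    and act_mul: "\<lbrakk>x \<in> topspace X; g \<in> arrows G; h \<in> arrows G; mom x = rng G g; src G g = rng G h\<rbrakk>
          \<Longrightarrow> act x (gmul G g h) = act (act x g) h"
    and free: "\<lbrakk>x \<in> topspace X; g \<in> arrows G; mom x = rng G g; act x g = x\<rbrakk> \<Longrightarrow> g \<in> units G"
    and proper: "proper_map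
          (subtopology (prod_topology X (gtop G)) {(x, g). mom x = rng G g})
          (prod_topology X X) (\<lambda>(x, g). (x, act x g))"

text \<open>The quotient topology on a set of orbits, \<open>orb x\<close> being the orbit of \<open>x\<close>.\<close>
definition orbit_topology :: "'x topology \<Rightarrow> ('x \<Rightarrow> 'x set) \<Rightarrow> 'x set topology" where
  "orbit_topology X orb =
     topology (\<lambda>U. U \<subseteq> orb ` topspace X \<and> openin X {x \<in> topspace X. orb x \<in> U})"

lemma openin_orbit_topology:
  "openin (orbit_topology X orb) U \<longleftrightarrow>
     U \<subseteq> orb ` topspace X \<and> openin X {x \<in> topspace X. orb x \<in> U}"
proof -
  let ?P = "\<lambda>U. U \<subseteq> orb ` topspace X \<and> openin X {x \<in> topspace X. orb x \<in> U}"
  have "istopology ?P"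
    unfolding istopology_def
  proof (intro conjI allI impI)
    fix S T assume "?P S" "?P T"
    moreover have "{x \<in> topspace X. orb x \<in> S \<inter> T} =
        {x \<in> topspace X. orb x \<in> S} \<inter> {x \<in> topspace X. orb x \<in> T}" by auto
    ultimately show "S \<inter> T \<subseteq> orb ` topspace X"
      "openin X {x \<in> topspace X. orb x \<in> S \<inter> T}" by auto
  next
    fix \<U> assume U: "\<forall>S\<in>\<U>. ?P S"
    then show "\<Union>\<U> \<subseteq> orb ` topspace X" by blast
    have "{x \<in> topspace X. orb x \<in> \<Union>\<U>} = (\<Union>S\<in>\<U>. {x \<in> topspace X. orb x \<in> S})" by auto
    with U show "openin X {x \<in> topspace X. orb x \<in> \<Union>\<U>}" by auto
  qed
  then show ?thesis by (simp add: orbit_topology_def topology_inverse')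
qed

record ('t, 'h, 'k) equivalence_data =
  ttop  :: "'t topology"
  lmom  :: "'t \<Rightarrow> 'h"
  rmom  :: "'t \<Rightarrow> 'k"
  tlact :: "'h \<Rightarrow> 't \<Rightarrow> 't"
  tract :: "'t \<Rightarrow> 'k \<Rightarrow> 't"

abbreviation points :: "('t, 'h, 'k, 'z) equivalence_data_scheme \<Rightarrow> 't set" where
  "points T \<equiv> topspace (ttop T)"

definition left_orbit where
  "left_orbit H T t = {tlact T h t | h. h \<in> arrows H \<and> src H h = lmom T t}"

definition right_orbit where
  "right_orbit K T t = {tract T t k | k. k \<in> arrows K \<and> rmom T t = rng K k}"

locale groupoid_equivalence =
  L: free_proper_left_space H "ttop T" "lmom T" "tlact T" +
  R: free_proper_right_space K "ttop T" "rmom T" "tract T"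
  for H :: "'h groupoid_data" and K :: "'k groupoid_data"
    and T :: "('t, 'h, 'k) equivalence_data" +
  assumes locally_compact_T: "locally_compact_space (ttop T)"
    and Hausdorff_T: "Hausdorff_space (ttop T)"
    and lmom_invariant: "\<lbrakk>t \<in> points T; k \<in> arrows K; rmom T t = rng K k\<rbrakk>
          \<Longrightarrow> lmom T (tract T t k) = lmom T t"
    and rmom_invariant: "\<lbrakk>h \<in> arrows H; t \<in> points T; src H h = lmom T t\<rbrakk>
          \<Longrightarrow> rmom T (tlact T h t) = rmom T t"
    and actions_commute: "\<lbrakk>h \<in> arrows H; t \<in> points T; k \<in> arrows K;
            src H h = lmom T t; rmom T t = rng K k\<rbrakk>
          \<Longrightarrow> tract T (tlact T h t) k = tlact T h (tract T t k)"
    and lmom_open: "open_map (ttop T) (subtopology (gtop H) (units H)) (lmom T)"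
    and rmom_open: "open_map (ttop T) (subtopology (gtop K) (units K)) (rmom T)"
    and lmom_homeo: "\<exists>f. homeomorphic_map (orbit_topology (ttop T) (right_orbit K T))
            (subtopology (gtop H) (units H)) f \<and>
          (\<forall>t\<in>points T. f (right_orbit K T t) = lmom T t)"
    and rmom_homeo: "\<exists>f. homeomorphic_map (orbit_topology (ttop T) (left_orbit H T))
            (subtopology (gtop K) (units K)) f \<and>
          (\<forall>t\<in>points T. f (left_orbit H T t) = rmom T t)"

text \<open>For a groupoid equivalence these are the unique elements with \<open>h \<cdot> t' = t\<close> (where \<open>t\<close> and
  \<open>t'\<close> have the same right moment) and \<open>t \<cdot> k = t'\<close> (same left moment), respectively.\<close>
definition tauL :: "'h groupoid_data \<Rightarrow> ('t, 'h, 'k) equivalence_data \<Rightarrow> 't \<Rightarrow> 't \<Rightarrow> 'h" where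
  "tauL H T t t' = (THE h. h \<in> arrows H \<and> src H h = lmom T t' \<and> tlact T h t' = t)"

definition tauR :: "'k groupoid_data \<Rightarrow> ('t, 'h, 'k) equivalence_data \<Rightarrow> 't \<Rightarrow> 't \<Rightarrow> 'k" where
  "tauR K T t t' = (THE k. k \<in> arrows K \<and> rmom T t = rng K k \<and> tract T t k = t')"

section \<open>Fell bundles and their ideals\<close>

record ('b, 'g) fell_data = "('b, 'g) bundle_data" +
  bmul  :: "'b \<Rightarrow> 'b \<Rightarrow> 'b"
  bstar :: "'b \<Rightarrow> 'b"

definition fibre_alg :: "('b, 'g) fell_data \<Rightarrow> 'g \<Rightarrow> 'b calg" where
  "fibre_alg \<B> u = \<lparr>carr = fib \<B> u, vadd = badd \<B>, vzero = bzero \<B> u, vsc = bsc \<B>, vnorm = bnorm \<B>,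
     amul = bmul \<B>, astar = bstar \<B>\<rparr>"

locale fell_bundle = lch_groupoid G + banach_bundle "gtop G" \<B>
  for G :: "'g groupoid_data" and \<B> :: "('b, 'g) fell_data" +
  assumes bmul_continuous: "continuous_map
          (subtopology (prod_topology (btop \<B>) (btop \<B>)) {(a, b). src G (proj \<B> a) = rng G (proj \<B> b)})
          (btop \<B>) (\<lambda>(a, b). bmul \<B> a b)"
    and bmul_add_left: "\<lbrakk>g \<in> arrows G; h \<in> arrows G; src G g = rng G h;
            a \<in> fib \<B> g; a' \<in> fib \<B> g; b \<in> fib \<B> h\<rbrakk>
          \<Longrightarrow> bmul \<B> (badd \<B> a a') b = badd \<B> (bmul \<B> a b) (bmul \<B> a' b)"
    and bmul_add_right: "\<lbrakk>g \<in> arrows G; h \<in> arrows G; src G g = rng G h;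
            a \<in> fib \<B> g; b \<in> fib \<B> h; b' \<in> fib \<B> h\<rbrakk>
          \<Longrightarrow> bmul \<B> a (badd \<B> b b') = badd \<B> (bmul \<B> a b) (bmul \<B> a b')"
    and bmul_sc_left: "\<lbrakk>g \<in> arrows G; h \<in> arrows G; src G g = rng G h; a \<in> fib \<B> g; b \<in> fib \<B> h\<rbrakk>
          \<Longrightarrow> bmul \<B> (bsc \<B> c a) b = bsc \<B> c (bmul \<B> a b)"
    and bmul_sc_right: "\<lbrakk>g \<in> arrows G; h \<in> arrows G; src G g = rng G h; a \<in> fib \<B> g; b \<in> fib \<B> h\<rbrakk>
          \<Longrightarrow> bmul \<B> a (bsc \<B> c b) = bsc \<B> c (bmul \<B> a b)"
    and bmul_assoc: "\<lbrakk>g \<in> arrows G; h \<in> arrows G; k \<in> arrows G; src G g = rng G h; src G h = rng G k;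
            a \<in> fib \<B> g; b \<in> fib \<B> h; d \<in> fib \<B> k\<rbrakk>
          \<Longrightarrow> bmul \<B> (bmul \<B> a b) d = bmul \<B> a (bmul \<B> b d)"
    and proj_bmul: "\<lbrakk>g \<in> arrows G; h \<in> arrows G; src G g = rng G h; a \<in> fib \<B> g; b \<in> fib \<B> h\<rbrakk>
          \<Longrightarrow> proj \<B> (bmul \<B> a b) = gmul G g h"
    and bstar_continuous: "continuous_map (btop \<B>) (btop \<B>) (bstar \<B>)"
    and bstar_bstar: "\<lbrakk>g \<in> arrows G; a \<in> fib \<B> g\<rbrakk> \<Longrightarrow> bstar \<B> (bstar \<B> a) = a"
    and bstar_add: "\<lbrakk>g \<in> arrows G; a \<in> fib \<B> g; b \<in> fib \<B> g\<rbrakk>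
          \<Longrightarrow> bstar \<B> (badd \<B> a b) = badd \<B> (bstar \<B> a) (bstar \<B> b)"
    and bstar_sc: "\<lbrakk>g \<in> arrows G; a \<in> fib \<B> g\<rbrakk> \<Longrightarrow> bstar \<B> (bsc \<B> c a) = bsc \<B> (cnj c) (bstar \<B> a)"
    and proj_bstar: "\<lbrakk>g \<in> arrows G; a \<in> fib \<B> g\<rbrakk> \<Longrightarrow> proj \<B> (bstar \<B> a) = ginv G g"
    and bstar_bmul: "\<lbrakk>g \<in> arrows G; h \<in> arrows G; src G g = rng G h; a \<in> fib \<B> g; b \<in> fib \<B> h\<rbrakk>
          \<Longrightarrow> bstar \<B> (bmul \<B> a b) = bmul \<B> (bstar \<B> b) (bstar \<B> a)"
    and fibre_cstar: "u \<in> units G \<Longrightarrow> cstar_algebra (fibre_alg \<B> u)"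
    and fibre_imprimitivity: "g \<in> arrows G \<Longrightarrow>
          imprimitivity_bimodule (fibre_alg \<B> (rng G g)) (fibre_alg \<B> (src G g)) (fibre \<B> g)
            (bmul \<B>) (bmul \<B>) (\<lambda>a b. bmul \<B> a (bstar \<B> b)) (\<lambda>a b. bmul \<B> (bstar \<B> a) b)"

definition fell_subbundle :: "'g groupoid_data \<Rightarrow> ('b, 'g) fell_data \<Rightarrow> 'b set \<Rightarrow> bool" where
  "fell_subbundle G \<B> \<D> \<longleftrightarrow> banach_subbundle (gtop G) \<B> \<D> \<and> fell_bundle G (\<B> \<restriction>\<^sub>b \<D>)"

definition fell_ideal :: "'g groupoid_data \<Rightarrow> ('b, 'g) fell_data \<Rightarrow> 'b set \<Rightarrow> bool" where
  "fell_ideal G \<B> \<J> \<longleftrightarrow>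
     fell_subbundle G \<B> \<J> \<and>
     (\<forall>a\<in>topspace (btop \<B>). \<forall>b\<in>topspace (btop \<B>).
        src G (proj \<B> a) = rng G (proj \<B> b) \<and> (a \<in> \<J> \<or> b \<in> \<J>) \<longrightarrow> bmul \<B> a b \<in> \<J>)"

section \<open>Fell-bundle equivalences\<close>

record ('e, 't, 'b, 'c) fell_equiv_data = "('e, 't) bundle_data" +
  lact :: "'b \<Rightarrow> 'e \<Rightarrow> 'e"
  ract :: "'e \<Rightarrow> 'c \<Rightarrow> 'e"
  lip  :: "'e \<Rightarrow> 'e \<Rightarrow> 'b"
  rip  :: "'e \<Rightarrow> 'e \<Rightarrow> 'c"

locale fell_left_action =
  fixes H :: "'h groupoid_data" and T :: "('t, 'h, 'k) equivalence_data"
    and \<B> :: "('b, 'h) fell_data" and \<E> :: "('e, 't, 'b, 'c) fell_equiv_data"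
  assumes lact_continuous: "continuous_map
          (subtopology (prod_topology (btop \<B>) (btop \<E>)) {(b, e). src H (proj \<B> b) = lmom T (proj \<E> e)})
          (btop \<E>) (\<lambda>(b, e). lact \<E> b e)"
    and proj_lact: "\<lbrakk>b \<in> topspace (btop \<B>); e \<in> topspace (btop \<E>);
            src H (proj \<B> b) = lmom T (proj \<E> e)\<rbrakk>
          \<Longrightarrow> proj \<E> (lact \<E> b e) = tlact T (proj \<B> b) (proj \<E> e)"
    and lact_assoc: "\<lbrakk>a \<in> topspace (btop \<B>); b \<in> topspace (btop \<B>); e \<in> topspace (btop \<E>);
            src H (proj \<B> a) = rng H (proj \<B> b); src H (proj \<B> b) = lmom T (proj \<E> e)\<rbrakk>
          \<Longrightarrow> lact \<E> a (lact \<E> b e) = lact \<E> (bmul \<B> a b) e"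
    and lact_norm: "\<lbrakk>b \<in> topspace (btop \<B>); e \<in> topspace (btop \<E>);
            src H (proj \<B> b) = lmom T (proj \<E> e)\<rbrakk>
          \<Longrightarrow> bnorm \<E> (lact \<E> b e) \<le> bnorm \<B> b * bnorm \<E> e"

locale fell_right_action =
  fixes K :: "'k groupoid_data" and T :: "('t, 'h, 'k) equivalence_data"
    and \<C> :: "('c, 'k) fell_data" and \<E> :: "('e, 't, 'b, 'c) fell_equiv_data"
  assumes ract_continuous: "continuous_map
          (subtopology (prod_topology (btop \<E>) (btop \<C>)) {(e, c). rmom T (proj \<E> e) = rng K (proj \<C> c)})
          (btop \<E>) (\<lambda>(e, c). ract \<E> e c)"
    and proj_ract: "\<lbrakk>e \<in> topspace (btop \<E>); c \<in> topspace (btop \<C>);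
            rmom T (proj \<E> e) = rng K (proj \<C> c)\<rbrakk>
          \<Longrightarrow> proj \<E> (ract \<E> e c) = tract T (proj \<E> e) (proj \<C> c)"
    and ract_assoc: "\<lbrakk>e \<in> topspace (btop \<E>); c \<in> topspace (btop \<C>); d \<in> topspace (btop \<C>);
            rmom T (proj \<E> e) = rng K (proj \<C> c); src K (proj \<C> c) = rng K (proj \<C> d)\<rbrakk>
          \<Longrightarrow> ract \<E> (ract \<E> e c) d = ract \<E> e (bmul \<C> c d)"
    and ract_norm: "\<lbrakk>e \<in> topspace (btop \<E>); c \<in> topspace (btop \<C>);
            rmom T (proj \<E> e) = rng K (proj \<C> c)\<rbrakk>
          \<Longrightarrow> bnorm \<E> (ract \<E> e c) \<le> bnorm \<E> e * bnorm \<C> c"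

locale fell_equivalence =
  groupoid_equivalence H K T + B: fell_bundle H \<B> + C: fell_bundle K \<C> +
  E: banach_bundle "ttop T" \<E> + fell_left_action H T \<B> \<E> + fell_right_action K T \<C> \<E>
  for H :: "'h groupoid_data" and K :: "'k groupoid_data"
    and T :: "('t, 'h, 'k) equivalence_data"
    and \<B> :: "('b, 'h) fell_data" and \<C> :: "('c, 'k) fell_data"
    and \<E> :: "('e, 't, 'b, 'c) fell_equiv_data" +
  assumes lact_ract: "\<lbrakk>b \<in> topspace (btop \<B>); e \<in> topspace (btop \<E>); c \<in> topspace (btop \<C>);
            src H (proj \<B> b) = lmom T (proj \<E> e); rmom T (proj \<E> e) = rng K (proj \<C> c)\<rbrakk>
          \<Longrightarrow> lact \<E> b (ract \<E> e c) = ract \<E> (lact \<E> b e) c"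
    and lip_continuous: "continuous_map
          (subtopology (prod_topology (btop \<E>) (btop \<E>)) {(e, f). rmom T (proj \<E> e) = rmom T (proj \<E> f)})
          (btop \<B>) (\<lambda>(e, f). lip \<E> e f)"
    and rip_continuous: "continuous_map
          (subtopology (prod_topology (btop \<E>) (btop \<E>)) {(e, f). lmom T (proj \<E> e) = lmom T (proj \<E> f)})
          (btop \<C>) (\<lambda>(e, f). rip \<E> e f)"
    and lip_add_left: "\<lbrakk>t \<in> points T; t' \<in> points T; rmom T t = rmom T t';
            e \<in> fib \<E> t; e' \<in> fib \<E> t; f \<in> fib \<E> t'\<rbrakk>
          \<Longrightarrow> lip \<E> (badd \<E> e e') f = badd \<B> (lip \<E> e f) (lip \<E> e' f)"
    and lip_add_right: "\<lbrakk>t \<in> points T; t' \<in> points T; rmom T t = rmom T t';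
            e \<in> fib \<E> t; f \<in> fib \<E> t'; f' \<in> fib \<E> t'\<rbrakk>
          \<Longrightarrow> lip \<E> e (badd \<E> f f') = badd \<B> (lip \<E> e f) (lip \<E> e f')"
    and lip_sc_left: "\<lbrakk>t \<in> points T; t' \<in> points T; rmom T t = rmom T t'; e \<in> fib \<E> t; f \<in> fib \<E> t'\<rbrakk>
          \<Longrightarrow> lip \<E> (bsc \<E> z e) f = bsc \<B> z (lip \<E> e f)"
    and lip_sc_right: "\<lbrakk>t \<in> points T; t' \<in> points T; rmom T t = rmom T t'; e \<in> fib \<E> t; f \<in> fib \<E> t'\<rbrakk>
          \<Longrightarrow> lip \<E> e (bsc \<E> z f) = bsc \<B> (cnj z) (lip \<E> e f)"
    and rip_add_left: "\<lbrakk>t \<in> points T; t' \<in> points T; lmom T t = lmom T t';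
            e \<in> fib \<E> t; e' \<in> fib \<E> t; f \<in> fib \<E> t'\<rbrakk>
          \<Longrightarrow> rip \<E> (badd \<E> e e') f = badd \<C> (rip \<E> e f) (rip \<E> e' f)"
    and rip_add_right: "\<lbrakk>t \<in> points T; t' \<in> points T; lmom T t = lmom T t';
            e \<in> fib \<E> t; f \<in> fib \<E> t'; f' \<in> fib \<E> t'\<rbrakk>
          \<Longrightarrow> rip \<E> e (badd \<E> f f') = badd \<C> (rip \<E> e f) (rip \<E> e f')"
    and rip_sc_left: "\<lbrakk>t \<in> points T; t' \<in> points T; lmom T t = lmom T t'; e \<in> fib \<E> t; f \<in> fib \<E> t'\<rbrakk>
          \<Longrightarrow> rip \<E> (bsc \<E> z e) f = bsc \<C> (cnj z) (rip \<E> e f)"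
    and rip_sc_right: "\<lbrakk>t \<in> points T; t' \<in> points T; lmom T t = lmom T t'; e \<in> fib \<E> t; f \<in> fib \<E> t'\<rbrakk>
          \<Longrightarrow> rip \<E> e (bsc \<E> z f) = bsc \<C> z (rip \<E> e f)"
    and proj_lip: "\<lbrakk>e \<in> topspace (btop \<E>); f \<in> topspace (btop \<E>);
            rmom T (proj \<E> e) = rmom T (proj \<E> f)\<rbrakk>
          \<Longrightarrow> proj \<B> (lip \<E> e f) = tauL H T (proj \<E> e) (proj \<E> f)"
    and proj_rip: "\<lbrakk>e \<in> topspace (btop \<E>); f \<in> topspace (btop \<E>);
            lmom T (proj \<E> e) = lmom T (proj \<E> f)\<rbrakk>
          \<Longrightarrow> proj \<C> (rip \<E> e f) = tauR K T (proj \<E> e) (proj \<E> f)"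
    and lip_star: "\<lbrakk>e \<in> topspace (btop \<E>); f \<in> topspace (btop \<E>);
            rmom T (proj \<E> e) = rmom T (proj \<E> f)\<rbrakk>
          \<Longrightarrow> bstar \<B> (lip \<E> e f) = lip \<E> f e"
    and rip_star: "\<lbrakk>e \<in> topspace (btop \<E>); f \<in> topspace (btop \<E>);
            lmom T (proj \<E> e) = lmom T (proj \<E> f)\<rbrakk>
          \<Longrightarrow> bstar \<C> (rip \<E> e f) = rip \<E> f e"
    and lip_lact: "\<lbrakk>b \<in> topspace (btop \<B>); e \<in> topspace (btop \<E>); f \<in> topspace (btop \<E>);
            src H (proj \<B> b) = lmom T (proj \<E> e); rmom T (proj \<E> e) = rmom T (proj \<E> f)\<rbrakk>
          \<Longrightarrow> lip \<E> (lact \<E> b e) f = bmul \<B> b (lip \<E> e f)"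
    and rip_ract: "\<lbrakk>e \<in> topspace (btop \<E>); f \<in> topspace (btop \<E>); c \<in> topspace (btop \<C>);
            lmom T (proj \<E> e) = lmom T (proj \<E> f); rmom T (proj \<E> f) = rng K (proj \<C> c)\<rbrakk>
          \<Longrightarrow> rip \<E> e (ract \<E> f c) = bmul \<C> (rip \<E> e f) c"
    and lip_rip: "\<lbrakk>e \<in> topspace (btop \<E>); f \<in> topspace (btop \<E>); g \<in> topspace (btop \<E>);
            rmom T (proj \<E> e) = rmom T (proj \<E> f); lmom T (proj \<E> f) = lmom T (proj \<E> g)\<rbrakk>
          \<Longrightarrow> lact \<E> (lip \<E> e f) g = ract \<E> e (rip \<E> f g)"
    and fibre_equiv: "t \<in> points T \<Longrightarrow>
          imprimitivity_bimodule (fibre_alg \<B> (lmom T t)) (fibre_alg \<C> (rmom T t)) (fibre \<E> t)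
            (lact \<E>) (ract \<E>) (lip \<E>) (rip \<E>)"

section \<open>Submodules and the correspondence\<close>

text \<open>The linear span of \<open>S \<cdot> Y\<close> (resp. \<open>Y \<cdot> S\<close>), formed in the fibre over \<open>t\<close>.\<close>
definition lprod :: "('e, 't, 'b, 'c) fell_equiv_data \<Rightarrow> 't \<Rightarrow> 'b set \<Rightarrow> 'e set \<Rightarrow> 'e set" where
  "lprod \<E> t S Y = lin_span (fibre \<E> t) {lact \<E> b e | b e. b \<in> S \<and> e \<in> Y}"

definition rprod :: "('e, 't, 'b, 'c) fell_equiv_data \<Rightarrow> 't \<Rightarrow> 'e set \<Rightarrow> 'c set \<Rightarrow> 'e set" where
  "rprod \<E> t Y S = lin_span (fibre \<E> t) {ract \<E> e c | e c. e \<in> Y \<and> c \<in> S}"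

definition banach_submodule where
  "banach_submodule (H :: 'h groupoid_data) (K :: 'k groupoid_data)
       (T :: ('t, 'h, 'k) equivalence_data)
       (\<B> :: ('b, 'h) fell_data) (\<C> :: ('c, 'k) fell_data)
       (\<E> :: ('e, 't, 'b, 'c) fell_equiv_data) \<M> \<longleftrightarrow>
     banach_subbundle (ttop T) \<E> \<M> \<and>
     (\<forall>h\<in>arrows H. \<forall>t\<in>points T. src H h = lmom T t \<longrightarrow>
        lprod \<E> (tlact T h t) (fib \<B> h) (\<M> \<inter> fib \<E> t) \<subseteq> \<M> \<inter> fib \<E> (tlact T h t)) \<and>
     (\<forall>t\<in>points T. \<forall>k\<in>arrows K. rmom T t = rng K k \<longrightarrow>
        rprod \<E> (tract T t k) (\<M> \<inter> fib \<E> t) (fib \<C> k) \<subseteq> \<M> \<inter> fib \<E> (tract T t k))"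

definition full_banach_submodule where
  "full_banach_submodule (H :: 'h groupoid_data) (K :: 'k groupoid_data)
       (T :: ('t, 'h, 'k) equivalence_data)
       (\<B> :: ('b, 'h) fell_data) (\<C> :: ('c, 'k) fell_data)
       (\<E> :: ('e, 't, 'b, 'c) fell_equiv_data) \<M> \<longleftrightarrow>
     banach_submodule H K T \<B> \<C> \<E> \<M> \<and>
     (\<forall>h\<in>arrows H. \<forall>t\<in>points T. src H h = lmom T t \<longrightarrow>
        norm_topology (fibre \<E> (tlact T h t)) closure_of
          lprod \<E> (tlact T h t) (fib \<B> h) (\<M> \<inter> fib \<E> t) = \<M> \<inter> fib \<E> (tlact T h t)) \<and>
     (\<forall>t\<in>points T. \<forall>k\<in>arrows K. rmom T t = rng K k \<longrightarrow>
        norm_topology (fibre \<E> (tract T t k)) closure_of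
          rprod \<E> (tract T t k) (\<M> \<inter> fib \<E> t) (fib \<C> k) = \<M> \<inter> fib \<E> (tract T t k))"

definition module_times_ideal where
  "module_times_ideal (T :: ('t, 'h, 'k) equivalence_data)
       (\<C> :: ('c, 'k) fell_data) (\<E> :: ('e, 't, 'b, 'c) fell_equiv_data) \<J> =
     (\<Union>t\<in>points T. rprod \<E> t (fib \<E> t) (\<J> \<inter> fib \<C> (rmom T t)))"

definition ideal_times_module where
  "ideal_times_module (T :: ('t, 'h, 'k) equivalence_data)
       (\<B> :: ('b, 'h) fell_data) (\<E> :: ('e, 't, 'b, 'c) fell_equiv_data) \<K> =
     (\<Union>t\<in>points T. lprod \<E> t (\<K> \<inter> fib \<B> (lmom T t)) (fib \<E> t))"

end

theory Submission
  imports Defs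
begin

text \<open>Almost every axiom of a Fell-bundle equivalence is an equation, an inequality or a continuity
  condition, and these pass to \<open>\<K>\<close>, \<open>\<M>\<close> and \<open>\<J>\<close> as soon as the operations stay inside these
  sets. The actions stay in \<open>\<M>\<close> because \<open>\<M>\<close> is a submodule. For the inner products both
  descriptions of \<open>\<M>\<close> are used: \<open>\<M> = \<K> \<cdot> \<E>\<close> and \<open>\<langle>k e, f\<rangle> = k \<langle>e, f\<rangle>\<close> put the left one into \<open>\<K>\<close>
  (\<open>lip_ideal_times_module\<close>), and \<open>\<M> = \<E> \<cdot> \<J>\<close> puts the right one into \<open>\<J>\<close>
  (\<open>rip_module_times_ideal\<close>).

  Two axioms of the imprimitivity bimodules \<open>M\<^sub>t\<close> need an argument. Positivity refers to a spectrum, which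
  is now computed in the smaller algebra; since \<open>K\<^sub>u\<close> is an ideal, the inverses in question
  already lie in its unitization (\<open>spectrum_subset\<close>). Fullness asks for the inner products of \<open>M\<^sub>t\<close> to
  span a dense subspace of \<open>K\<^sub>u\<close>, where \<open>u = \<rho>(t)\<close>. The identity \<open>k \<langle>x, y\<rangle> l = \<langle>k x, l\<^sup>* y\<rangle>\<close> for
  \<open>x, y \<in> E\<^sub>t\<close> and \<open>k, l \<in> K\<^sub>u\<close> shows that their closed span contains \<open>K\<^sub>u B\<^sub>u K\<^sub>u\<close>, because \<open>E\<^sub>t\<close> is full; and the
  products \<open>K\<^sub>u K\<^sub>u K\<^sub>u\<close> span a dense subspace of \<open>K\<^sub>u\<close> (\<open>dense_span_compression\<close>). The last fact is itself an
  instance of fullness: \<open>\<K>\<close> is a Fell bundle, and its bimodule over the unit \<open>u\<close> is \<open>K\<^sub>u\<close> with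
  inner product \<open>a\<^sup>* b\<close> (\<open>fell_ideal_fibre\<close>). The right-hand side is symmetric.\<close>

section \<open>Closed linear spans\<close>

context complex_banach
begin

lemma dist_eq: "a \<in> carr V \<Longrightarrow> b \<in> carr V \<Longrightarrow> vdist V a b = vnorm V (vadd V a (vsc V (-1) b))"
  by (simp add: vdist_def)

lemma sc_zero: "a \<in> carr V \<Longrightarrow> vsc V 0 a = vzero V"
  using add_sc[of a 1 "-1"] by (simp add: sc_one add_minus)

lemma zero_add: "a \<in> carr V \<Longrightarrow> vadd V (vzero V) a = a"
  by (metis add_commute add_zero zero_closed)

lemma add_swap:
  assumes "a \<in> carr V" "b \<in> carr V" "c \<in> carr V" "d \<in> carr V"
  shows "vadd V (vadd V a b) (vadd V c d) = vadd V (vadd V a c) (vadd V b d)"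
  by (metis assms add_assoc add_closed add_commute)

lemma dist_scale:
  assumes "a \<in> carr V" "b \<in> carr V"
  shows "vdist V (vsc V c a) (vsc V c b) = cmod c * vdist V a b"
proof -
  have "vadd V (vsc V c a) (vsc V (-1) (vsc V c b)) = vsc V c (vadd V a (vsc V (-1) b))"
    using assms by (simp add: sc_add sc_closed sc_sc)
  then show ?thesis using assms by (simp add: dist_eq sc_closed add_closed norm_sc)
qed

lemma dist_add:
  assumes "a \<in> carr V" "b \<in> carr V" "a' \<in> carr V" "b' \<in> carr V"
  shows "vdist V (vadd V a b) (vadd V a' b') \<le> vdist V a a' + vdist V b b'"
proof -
  have "vadd V (vadd V a b) (vsc V (-1) (vadd V a' b'))
      = vadd V (vadd V a (vsc V (-1) a')) (vadd V b (vsc V (-1) b'))"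
    using assms by (simp add: sc_add sc_closed add_swap)
  then show ?thesis using assms by (simp add: dist_eq sc_closed add_closed norm_triangle)
qed

lemma metric: "Metric_space (carr V) (vdist V)"
proof
  fix x y z
  show "0 \<le> vdist V x y" by (simp add: vdist_def norm_nonneg add_closed sc_closed)
  have diff_flip: "vadd V y (vsc V (-1) x) = vsc V (-1) (vadd V x (vsc V (-1) y))"
    if "x \<in> carr V" "y \<in> carr V"
    using that by (simp add: sc_add sc_closed sc_sc sc_one add_commute)
  show "vdist V x y = vdist V y x"
  proof (cases "x \<in> carr V \<and> y \<in> carr V")
    case True
    with diff_flip show ?thesis by (simp add: dist_eq norm_sc add_closed sc_closed)
  qed (auto simp: vdist_def)
  assume x: "x \<in> carr V" and y: "y \<in> carr V"
  show "vdist V x y = 0 \<longleftrightarrow> x = y"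
  proof
    assume "vdist V x y = 0"
    with x y have "vadd V x (vsc V (-1) y) = vzero V"
      by (simp add: dist_eq norm_eq_zero add_closed sc_closed)
    with x y have "vadd V (vadd V x (vsc V (-1) y)) y = y" by (simp add: zero_add)
    moreover have "vadd V (vadd V x (vsc V (-1) y)) y = x"
      using x y by (metis add_assoc add_commute add_minus add_zero sc_closed)
    ultimately show "x = y" by simp
  next
    assume "x = y"
    with x show "vdist V x y = 0" by (simp add: dist_eq add_minus norm_eq_zero zero_closed)
  qed
  assume z: "z \<in> carr V"
  have "vadd V x (vsc V (-1) z) = vadd V (vadd V x (vsc V (-1) y)) (vadd V y (vsc V (-1) z))"
    using x y z by (metis add_assoc add_closed add_commute add_minus add_zero sc_closed)
  with x y z show "vdist V x z \<le> vdist V x y + vdist V y z"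
    by (simp add: dist_eq norm_triangle add_closed sc_closed)
qed

lemma closure_of_iff:
  "x \<in> norm_topology V closure_of S \<longleftrightarrow>
     x \<in> carr V \<and> (\<forall>r>0. \<exists>y\<in>S. y \<in> carr V \<and> vdist V x y < r)"
proof -
  interpret Metric_space "carr V" "vdist V" by (rule metric)
  show ?thesis unfolding norm_topology_def metric_closure_of by (auto simp: in_mball)
qed

lemma closure_closed: "norm_topology V closure_of S \<subseteq> carr V"
  by (auto simp: closure_of_iff)

lemma lin_span_closed: "S \<subseteq> carr V \<Longrightarrow> lin_span V S \<subseteq> carr V"
proof
  fix x assume "S \<subseteq> carr V" "x \<in> lin_span V S"
  from this(2) show "x \<in> carr V"
    by induction (use \<open>S \<subseteq> carr V\<close> in \<open>auto simp: zero_closed add_closed sc_closed\<close>)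
qed

lemma in_closure: "x \<in> carr V \<Longrightarrow> x \<in> S \<Longrightarrow> x \<in> norm_topology V closure_of S"
  unfolding closure_of_iff using Metric_space.mdist_zero[OF metric, of x] by auto

lemma lin_span_closure_lin_span:
  assumes "S \<subseteq> carr V"
  shows "lin_span V (norm_topology V closure_of lin_span V S) \<subseteq> norm_topology V closure_of lin_span V S"
proof
  fix x assume "x \<in> lin_span V (norm_topology V closure_of lin_span V S)"
  then show "x \<in> norm_topology V closure_of lin_span V S"
  proof induction
    case zero
    show ?case by (intro in_closure zero_closed lin_span.zero)
  next
    case (base a) then show ?case .
  next
    case (add a b)
    have "\<exists>y\<in>lin_span V S. y \<in> carr V \<and> vdist V (vadd V a b) y < r" if "r > 0" for r
    proof -
      from that add.IH obtain p q where "p \<in> lin_span V S" "p \<in> carr V" "vdist V a p < r/2"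
        and "q \<in> lin_span V S" "q \<in> carr V" "vdist V b q < r/2"
        unfolding closure_of_iff by (meson half_gt_zero)
      moreover have "a \<in> carr V" "b \<in> carr V" using add.IH closure_closed by auto
      ultimately show ?thesis
        using dist_add[of a b p q]
        by (intro bexI[of _ "vadd V p q"]) (auto simp: add_closed lin_span.add)
    qed
    with add.IH show ?case by (simp add: closure_of_iff add_closed)
  next
    case (scale a c)
    have "\<exists>y\<in>lin_span V S. y \<in> carr V \<and> vdist V (vsc V c a) y < r" if "r > 0" for r
    proof -
      (* The summand 1 covers c = 0. *)
      have "r / (cmod c + 1) > 0" using that by (simp add: add_nonneg_pos)
      with scale.IH obtain p where p: "p \<in> lin_span V S" "p \<in> carr V" "vdist V a p < r / (cmod c + 1)"
        unfolding closure_of_iff by meson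
      have a: "a \<in> carr V" using scale.IH closure_closed by auto
      have "0 \<le> vdist V a p" by (rule Metric_space.nonneg[OF metric])
      then have "cmod c * vdist V a p \<le> (cmod c + 1) * vdist V a p" by (simp add: mult_right_mono)
      also have "\<dots> < r"
        using p(3) by (simp add: pos_less_divide_eq add_nonneg_pos mult.commute)
      finally show ?thesis
        using p a by (intro bexI[of _ "vsc V c p"]) (auto simp: dist_scale sc_closed lin_span.scale)
    qed
    with scale.IH show ?case by (simp add: closure_of_iff sc_closed)
  qed
qed

end

lemma lin_span_mono: "S \<subseteq> S' \<Longrightarrow> lin_span V S \<subseteq> lin_span V S'"
proof
  fix x assume "S \<subseteq> S'" "x \<in> lin_span V S"
  from this(2) show "x \<in> lin_span V S'"
    by induction (use \<open>S \<subseteq> S'\<close> in \<open>auto intro: lin_span.intros\<close>)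
qed

lemma lin_span_image:
  assumes "complex_banach V" "complex_banach W"
    and closed: "\<And>x. x \<in> carr V \<Longrightarrow> f x \<in> carr W"
    and add: "\<And>x y. \<lbrakk>x \<in> carr V; y \<in> carr V\<rbrakk> \<Longrightarrow> f (vadd V x y) = vadd W (f x) (f y)"
    and scale: "\<And>c x. x \<in> carr V \<Longrightarrow> f (vsc V c x) = vsc W c (f x)"
    and S: "S \<subseteq> carr V" and x: "x \<in> lin_span V S"
  shows "f x \<in> lin_span W (f ` S)"
proof -
  interpret V: complex_banach V by fact
  interpret W: complex_banach W by fact
  have in_carr: "y \<in> carr V" if "y \<in> lin_span V S" for y
    using that V.lin_span_closed[OF S] by blast
  from x show ?thesis
  proof induction
    case zero
    have "f (vzero V) = vsc W 0 (f (vzero V))"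
      using scale[of "vzero V" 0] by (simp add: V.zero_closed V.sc_zero)
    then show ?case by (simp add: W.sc_zero closed V.zero_closed lin_span.zero)
  qed (simp_all add: assms(4,5) in_carr lin_span.intros)
qed

text \<open>Linearity carries the hypothesis on generators to their span, as the closure of a span is again a
  subspace, and boundedness carries it to the closure.\<close>
lemma bounded_linear_closed_span:
  assumes "complex_banach V" "complex_banach W"
    and closed: "\<And>x. x \<in> carr V \<Longrightarrow> f x \<in> carr W"
    and add: "\<And>x y. \<lbrakk>x \<in> carr V; y \<in> carr V\<rbrakk> \<Longrightarrow> f (vadd V x y) = vadd W (f x) (f y)"
    and scale: "\<And>c x. x \<in> carr V \<Longrightarrow> f (vsc V c x) = vsc W c (f x)"
    and bounded: "\<And>x. x \<in> carr V \<Longrightarrow> vnorm W (f x) \<le> C * vnorm V x"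
    and G: "G \<subseteq> carr V" and P: "P \<subseteq> carr W"
    and gen: "\<And>x. x \<in> G \<Longrightarrow> f x \<in> norm_topology W closure_of lin_span W P"
    and x: "x \<in> norm_topology V closure_of lin_span V G"
  shows "f x \<in> norm_topology W closure_of lin_span W P"
proof -
  interpret V: complex_banach V by fact
  interpret W: complex_banach W by fact
  let ?Q = "norm_topology W closure_of lin_span W P"
  have dist: "vdist W (f a) (f b) \<le> C * vdist V a b" if "a \<in> carr V" "b \<in> carr V" for a b
    using that bounded[of "vadd V a (vsc V (-1) b)"]
    by (simp add: V.dist_eq W.dist_eq closed add scale V.sc_closed V.add_closed)
  have span: "f y \<in> ?Q" if "y \<in> lin_span V G" for y
    using lin_span_image[OF assms(1,2) closed add scale G that]
      lin_span_mono[of "f ` G" ?Q W] W.lin_span_closure_lin_span[OF P] gen by blast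
  have xV: "x \<in> carr V" using x V.closure_closed by blast
  have "f x \<in> norm_topology W closure_of ?Q"
    unfolding W.closure_of_iff[of "f x" ?Q]
  proof (intro conjI allI impI)
    show "f x \<in> carr W" using closed xV .
    fix r :: real assume "r > 0"
    then have "r / (\<bar>C\<bar> + 1) > 0" by (simp add: add_nonneg_pos)
    with x obtain y where y: "y \<in> lin_span V G" "y \<in> carr V" "vdist V x y < r / (\<bar>C\<bar> + 1)"
      unfolding V.closure_of_iff by meson
    have "vdist W (f x) (f y) \<le> (\<bar>C\<bar> + 1) * vdist V x y"
      using dist[OF xV y(2)] Metric_space.nonneg[OF V.metric, of x y]
      by (smt (verit) mult_right_mono)
    also have "\<dots> < r"
      using y(3) by (simp add: pos_less_divide_eq add_nonneg_pos mult.commute)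
    finally show "\<exists>z\<in>?Q. z \<in> carr W \<and> vdist W (f x) z < r" using span y closed by blast
  qed
  then show ?thesis by simp
qed

section \<open>Ideals of C*-algebras and submodules of Hilbert modules\<close>

lemma lin_span_restrict_carrier: "lin_span (V\<lparr>carr := W\<rparr>) S = lin_span V S"
proof
  show "lin_span (V\<lparr>carr := W\<rparr>) S \<subseteq> lin_span V S"
  proof
    fix x assume "x \<in> lin_span (V\<lparr>carr := W\<rparr>) S"
    then show "x \<in> lin_span V S" by induction (auto intro: lin_span.intros)
  qed
  show "lin_span V S \<subseteq> lin_span (V\<lparr>carr := W\<rparr>) S"
  proof
    fix x assume "x \<in> lin_span V S"
    then show "x \<in> lin_span (V\<lparr>carr := W\<rparr>) S"
      by induction (use lin_span.intros[where V = "V\<lparr>carr := W\<rparr>" and S = S] in auto)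
  qed
qed

text \<open>In a closed ideal of a C*-algebra, approximate units give idempotency. It is part of the locale
  because the ideals that occur below are fibres of Fell bundles over units, where it can be read off from
  the fullness axiom.\<close>
locale cstar_ideal = A: cstar_algebra A + I: cstar_algebra "A\<lparr>carr := I\<rparr>"
  for A :: "'a calg" and I :: "'a set" +
  assumes subset: "I \<subseteq> carr A"
    and mul_left: "\<lbrakk>a \<in> carr A; b \<in> I\<rbrakk> \<Longrightarrow> amul A a b \<in> I"
    and mul_right: "\<lbrakk>a \<in> I; b \<in> carr A\<rbrakk> \<Longrightarrow> amul A a b \<in> I"
    and idempotent: "I \<subseteq> norm_topology (A\<lparr>carr := I\<rparr>) closure_of
          lin_span (A\<lparr>carr := I\<rparr>) {amul A a b | a b. a \<in> I \<and> b \<in> I}"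
begin

lemma in_carr: "a \<in> I \<Longrightarrow> a \<in> carr A"
  using subset by blast

text \<open>If \<open>b + w\<close> inverts \<open>z - a\<close> in the unitization of \<open>A\<close>, then \<open>z b = w a + a b\<close> puts \<open>b\<close> into the
  ideal. So the spectrum does not grow when \<open>A\<close> shrinks to the ideal.\<close>
lemma spectrum_subset:
  assumes a: "a \<in> I"
  shows "spectrum (A\<lparr>carr := I\<rparr>) a \<subseteq> spectrum A a"
proof
  fix z assume z: "z \<in> spectrum (A\<lparr>carr := I\<rparr>) a"
  show "z \<in> spectrum A a"
  proof (rule ccontr)
    assume "z \<notin> spectrum A a"
    then obtain b w where b: "b \<in> carr A" and zw: "z * w = 1"
      and eq: "vsc A z b = vadd A (vsc A w a) (amul A a b)"
        "vsc A z b = vadd A (vsc A w a) (amul A b a)"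
      unfolding spectrum_def by blast
    have "vsc A z b \<in> I"
      unfolding eq(1) using a b mul_right I.add_closed I.sc_closed by simp
    then have "vsc A w (vsc A z b) \<in> I" using I.sc_closed by simp
    moreover have "vsc A w (vsc A z b) = b"
      using b zw by (simp add: A.sc_sc A.sc_one mult.commute)
    ultimately have "b \<in> I" by simp
    moreover from z have "\<not> (\<exists>b\<in>I. \<exists>w. z * w = 1 \<and>
        vsc A z b = vadd A (vsc A w a) (amul A a b) \<and> vsc A z b = vadd A (vsc A w a) (amul A b a))"
      by (simp add: spectrum_def)
    ultimately show False using zw eq by blast
  qed
qed

lemma positive_elt_restrict: "a \<in> I \<Longrightarrow> positive_elt A a \<Longrightarrow> positive_elt (A\<lparr>carr := I\<rparr>) a"
  using spectrum_subset unfolding positive_elt_def by auto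

text \<open>For \<open>a, b \<in> I\<close> the bounded map \<open>x \<mapsto> a x b\<close> carries the generators \<open>G\<close> of \<open>A\<close> into \<open>P\<close>, so
  by continuity all of \<open>I A I\<close>, in particular \<open>I I I\<close>, lies in the closed span of \<open>P\<close>.
  Idempotency, used twice, passes from \<open>I I I\<close> to \<open>I\<close>.\<close>
lemma dense_span_compression:
  assumes G: "G \<subseteq> carr A" and dense: "carr A \<subseteq> norm_topology A closure_of lin_span A G"
    and P: "P \<subseteq> I"
    and compress: "\<And>a g b. \<lbrakk>a \<in> I; g \<in> G; b \<in> I\<rbrakk> \<Longrightarrow> amul A (amul A a g) b \<in> P"
  shows "norm_topology (A\<lparr>carr := I\<rparr>) closure_of lin_span (A\<lparr>carr := I\<rparr>) P = I"
proof -
  let ?I = "A\<lparr>carr := I\<rparr>"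
  let ?Q = "norm_topology ?I closure_of lin_span ?I P"
  let ?II = "{amul A a b | a b. a \<in> I \<and> b \<in> I}"
  have P': "P \<subseteq> carr ?I" and II: "?II \<subseteq> carr ?I" using P mul_right subset by auto
  have triple: "amul A (amul A a x) b \<in> ?Q" if "a \<in> I" "x \<in> carr A" "b \<in> I" for a x b
  proof (rule bounded_linear_closed_span[OF A.complex_banach_axioms I.complex_banach_axioms
        _ _ _ _ G P', where f = "\<lambda>x. amul A (amul A a x) b" and C = "vnorm A a * vnorm A b"])
    fix y assume y: "y \<in> carr A"
    have "vnorm A (amul A (amul A a y) b) \<le> vnorm A (amul A a y) * vnorm A b"
      using that y by (simp add: A.norm_mul A.mul_closed in_carr)
    also have "\<dots> \<le> (vnorm A a * vnorm A y) * vnorm A b"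
      using that y by (intro mult_right_mono) (auto simp: A.norm_mul A.norm_nonneg in_carr)
    finally show "vnorm ?I (amul A (amul A a y) b) \<le> vnorm A a * vnorm A b * vnorm A y"
      by (simp add: mult_ac)
  next
    fix g assume g: "g \<in> G"
    show "amul A (amul A a g) b \<in> ?Q"
      using compress[OF that(1) g that(3)] P by (intro I.in_closure lin_span.base) auto
  qed (use that dense mul_right in \<open>auto simp: in_carr A.mul_add_right A.mul_add_left A.mul_sc_right A.mul_sc_left A.mul_closed\<close>)
  have double: "amul A x b \<in> ?Q" if "x \<in> I" "b \<in> I" for x b
  proof (rule bounded_linear_closed_span[OF I.complex_banach_axioms I.complex_banach_axioms
        _ _ _ _ II P', where f = "\<lambda>x. amul A x b" and C = "vnorm A b"])
    show "x \<in> norm_topology ?I closure_of lin_span ?I ?II" using that idempotent by blast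
    fix y assume "y \<in> carr ?I"
    then show "vnorm ?I (amul A y b) \<le> vnorm A b * vnorm ?I y"
      using that A.norm_mul[of y b] by (simp add: in_carr mult.commute)
  next
    fix y assume "y \<in> ?II"
    then show "amul A y b \<in> ?Q" using that triple in_carr by auto
  qed (use that mul_right in \<open>auto simp: in_carr A.mul_add_left A.mul_sc_left\<close>)
  have "x \<in> ?Q" if "x \<in> I" for x
  proof (rule bounded_linear_closed_span[OF I.complex_banach_axioms I.complex_banach_axioms
        _ _ _ _ II P', where f = "\<lambda>x. x" and C = 1])
    show "x \<in> norm_topology ?I closure_of lin_span ?I ?II" using that idempotent by blast
  qed (use double in auto)
  then show ?thesis using I.closure_closed by fastforce
qed

end

text \<open>Fullness comes from \<open>a \<langle>x, y\<rangle> b = \<langle>a x, b\<^sup>* y\<rangle>\<close>, whose right-hand side is an inner product of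
  elements of \<open>Y\<close> when \<open>a, b \<in> I\<close>.\<close>
lemma full_left_hilbert_module_restrict:
  assumes "full_left_hilbert_module A X act ip" "cstar_ideal A I" "complex_banach (X\<lparr>carr := Y\<rparr>)"
    and Y: "Y \<subseteq> carr X"
    and act: "\<And>a x. \<lbrakk>a \<in> I; x \<in> carr X\<rbrakk> \<Longrightarrow> act a x \<in> Y"
    and ip: "\<And>x y. \<lbrakk>x \<in> Y; y \<in> Y\<rbrakk> \<Longrightarrow> ip x y \<in> I"
  shows "full_left_hilbert_module (A\<lparr>carr := I\<rparr>) (X\<lparr>carr := Y\<rparr>) act ip"
proof -
  interpret X: full_left_hilbert_module A X act ip by fact
  interpret I: cstar_ideal A I by fact
  have YX: "y \<in> carr X" if "y \<in> Y" for y using that Y by blast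
  have star: "astar A b \<in> I" if "b \<in> I" for b using I.I.star_closed that by simp
  have full: "norm_topology (A\<lparr>carr := I\<rparr>) closure_of
      lin_span (A\<lparr>carr := I\<rparr>) {ip x y | x y. x \<in> Y \<and> y \<in> Y} = I"
  proof (rule I.dense_span_compression[where G = "{ip x y | x y. x \<in> carr X \<and> y \<in> carr X}"])
    fix a g b assume a: "a \<in> I" and "g \<in> {ip x y | x y. x \<in> carr X \<and> y \<in> carr X}" and b: "b \<in> I"
    then obtain x y where x: "x \<in> carr X" and y: "y \<in> carr X" and g: "g = ip x y" by blast
    have bA: "b \<in> carr A" "astar A b \<in> carr A" using b star I.in_carr by auto
    have "ip x (act (astar A b) y) = astar A (amul A (astar A b) (ip y x))"
      using x y bA by (metis X.ip_act X.ip_star X.act_closed)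
    also have "\<dots> = amul A (ip x y) b"
      using x y bA by (simp add: X.A.star_mul X.ip_closed X.ip_star X.A.star_star)
    finally have "amul A (amul A a g) b = ip (act a x) (act (astar A b) y)"
      using a x y bA by (simp add: g X.ip_act X.act_closed X.ip_closed X.A.mul_assoc I.in_carr)
    then show "amul A (amul A a g) b \<in> {ip x y | x y. x \<in> Y \<and> y \<in> Y}"
      using act a b star x y by blast
  qed (use X.ip_closed X.ip_full ip in auto)
  have pos: "positive_elt (A\<lparr>carr := I\<rparr>) (ip x x)" if "x \<in> Y" for x
    using that by (simp add: I.positive_elt_restrict X.ip_pos ip YX)
  show ?thesis
  proof (intro full_left_hilbert_module.intro full_left_hilbert_module_axioms.intro)
  qed (use assms(3) full pos act ip in \<open>auto intro: I.I.cstar_algebra_axioms X.ip_definite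
      simp: YX I.in_carr X.act_add_left X.act_add_right X.act_sc_left X.act_sc_right X.act_mul X.ip_add X.ip_sc
        X.ip_act X.ip_star X.ip_norm\<close>)
qed

text \<open>Here the compression identity reads \<open>a \<langle>x, y\<rangle> b = \<langle>x a\<^sup>*, y b\<rangle>\<close>.\<close>
lemma full_right_hilbert_module_restrict:
  assumes "full_right_hilbert_module A X act ip" "cstar_ideal A I" "complex_banach (X\<lparr>carr := Y\<rparr>)"
    and Y: "Y \<subseteq> carr X"
    and act: "\<And>a x. \<lbrakk>x \<in> carr X; a \<in> I\<rbrakk> \<Longrightarrow> act x a \<in> Y"
    and ip: "\<And>x y. \<lbrakk>x \<in> Y; y \<in> Y\<rbrakk> \<Longrightarrow> ip x y \<in> I"
  shows "full_right_hilbert_module (A\<lparr>carr := I\<rparr>) (X\<lparr>carr := Y\<rparr>) act ip"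
proof -
  interpret X: full_right_hilbert_module A X act ip by fact
  interpret I: cstar_ideal A I by fact
  have YX: "y \<in> carr X" if "y \<in> Y" for y using that Y by blast
  have star: "astar A b \<in> I" if "b \<in> I" for b using I.I.star_closed that by simp
  have full: "norm_topology (A\<lparr>carr := I\<rparr>) closure_of
      lin_span (A\<lparr>carr := I\<rparr>) {ip x y | x y. x \<in> Y \<and> y \<in> Y} = I"
  proof (rule I.dense_span_compression[where G = "{ip x y | x y. x \<in> carr X \<and> y \<in> carr X}"])
    fix a g b assume a: "a \<in> I" and "g \<in> {ip x y | x y. x \<in> carr X \<and> y \<in> carr X}" and b: "b \<in> I"
    then obtain x y where x: "x \<in> carr X" and y: "y \<in> carr X" and g: "g = ip x y" by blast
    have aA: "a \<in> carr A" "astar A a \<in> carr A" using a star I.in_carr by auto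
    have "ip (act x (astar A a)) y = astar A (amul A (ip y x) (astar A a))"
      using x y aA by (metis X.ip_act X.ip_star X.act_closed)
    also have "\<dots> = amul A a (ip x y)"
      using x y aA by (simp add: X.A.star_mul X.ip_closed X.ip_star X.A.star_star)
    finally have "amul A (amul A a g) b = ip (act x (astar A a)) (act y b)"
      using b x y aA by (simp add: g X.ip_act X.act_closed I.in_carr)
    then show "amul A (amul A a g) b \<in> {ip x y | x y. x \<in> Y \<and> y \<in> Y}"
      using act a b star x y by blast
  qed (use X.ip_closed X.ip_full ip in auto)
  have pos: "positive_elt (A\<lparr>carr := I\<rparr>) (ip x x)" if "x \<in> Y" for x
    using that by (simp add: I.positive_elt_restrict X.ip_pos ip YX)
  show ?thesis
  proof (intro full_right_hilbert_module.intro full_right_hilbert_module_axioms.intro)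
  qed (use assms(3) full pos act ip in \<open>auto intro: I.I.cstar_algebra_axioms X.ip_definite
      simp: YX I.in_carr X.act_add_left X.act_add_right X.act_sc_left X.act_sc_right X.act_mul X.ip_add X.ip_sc
        X.ip_act X.ip_star X.ip_norm\<close>)
qed

lemma imprimitivity_bimodule_restrict:
  assumes "imprimitivity_bimodule A B X la ra li ri" "cstar_ideal A I" "cstar_ideal B J"
    and "complex_banach (X\<lparr>carr := Y\<rparr>)" "Y \<subseteq> carr X"
    and "\<And>a x. \<lbrakk>a \<in> I; x \<in> carr X\<rbrakk> \<Longrightarrow> la a x \<in> Y" "\<And>b x. \<lbrakk>x \<in> carr X; b \<in> J\<rbrakk> \<Longrightarrow> ra x b \<in> Y"
    and "\<And>x y. \<lbrakk>x \<in> Y; y \<in> Y\<rbrakk> \<Longrightarrow> li x y \<in> I" "\<And>x y. \<lbrakk>x \<in> Y; y \<in> Y\<rbrakk> \<Longrightarrow> ri x y \<in> J"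
  shows "imprimitivity_bimodule (A\<lparr>carr := I\<rparr>) (B\<lparr>carr := J\<rparr>) (X\<lparr>carr := Y\<rparr>) la ra li ri"
proof -
  interpret X: imprimitivity_bimodule A B X la ra li ri by fact
  interpret I: cstar_ideal A I by fact
  interpret J: cstar_ideal B J by fact
  have YX: "y \<in> carr X" if "y \<in> Y" for y using that assms(5) by blast
  show ?thesis
    by (intro imprimitivity_bimodule.intro imprimitivity_bimodule_axioms.intro
          full_left_hilbert_module_restrict full_right_hilbert_module_restrict)
      (use assms(2-) in \<open>auto intro: X.L.full_left_hilbert_module_axioms X.R.full_right_hilbert_module_axioms
        simp: YX I.in_carr J.in_carr X.bimodule X.left_adjoint X.right_adjoint X.ip_compat\<close>)
qed

section \<open>Restriction of bundles\<close>

lemma restrict_bundle_simps [simp]: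
  "btop (\<B> \<restriction>\<^sub>b \<D>) = subtopology (btop \<B>) \<D>" "proj (\<B> \<restriction>\<^sub>b \<D>) = proj \<B>"
  "badd (\<B> \<restriction>\<^sub>b \<D>) = badd \<B>" "bsc (\<B> \<restriction>\<^sub>b \<D>) = bsc \<B>" "bzero (\<B> \<restriction>\<^sub>b \<D>) = bzero \<B>"
  "bnorm (\<B> \<restriction>\<^sub>b \<D>) = bnorm \<B>"
  by (simp_all add: restrict_bundle_def)

lemma restrict_fell_simps [simp]:
  "bmul (\<C> \<restriction>\<^sub>b \<D>) = bmul \<C>" "bstar (\<C> \<restriction>\<^sub>b \<D>) = bstar \<C>"
  by (simp_all add: restrict_bundle_def)

lemma restrict_equiv_simps [simp]:
  "lact (\<E> \<restriction>\<^sub>b \<D>) = lact \<E>" "ract (\<E> \<restriction>\<^sub>b \<D>) = ract \<E>"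
  "lip (\<E> \<restriction>\<^sub>b \<D>) = lip \<E>" "rip (\<E> \<restriction>\<^sub>b \<D>) = rip \<E>"
  by (simp_all add: restrict_bundle_def)

lemma fib_restrict [simp]: "fib (\<B> \<restriction>\<^sub>b \<D>) x = \<D> \<inter> fib \<B> x"
  by (auto simp: fib_def)

lemma fibre_restrict: "fibre (\<B> \<restriction>\<^sub>b \<D>) x = fibre \<B> x\<lparr>carr := \<D> \<inter> fib \<B> x\<rparr>"
  by (simp add: fibre_def)

lemma fibre_alg_restrict: "fibre_alg (\<B> \<restriction>\<^sub>b \<D>) x = fibre_alg \<B> x\<lparr>carr := \<D> \<inter> fib \<B> x\<rparr>"
  by (simp add: fibre_alg_def)

lemma fibre_sel [simp]:
  "carr (fibre \<B> x) = fib \<B> x" "vadd (fibre \<B> x) = badd \<B>" "vzero (fibre \<B> x) = bzero \<B> x"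
  "vsc (fibre \<B> x) = bsc \<B>" "vnorm (fibre \<B> x) = bnorm \<B>"
  by (simp_all add: fibre_def)

lemma fibre_alg_sel [simp]:
  "carr (fibre_alg \<B> x) = fib \<B> x" "amul (fibre_alg \<B> x) = bmul \<B>" "astar (fibre_alg \<B> x) = bstar \<B>"
  by (simp_all add: fibre_alg_def)

lemma continuous_map_restrict_pairs:
  assumes f: "continuous_map (subtopology (prod_topology X Y) S) Z f"
    and C: "\<And>x y. \<lbrakk>x \<in> topspace X \<inter> A; y \<in> topspace Y \<inter> B; (x, y) \<in> S\<rbrakk> \<Longrightarrow> f (x, y) \<in> C"
  shows "continuous_map (subtopology (prod_topology (subtopology X A) (subtopology Y B)) S)
           (subtopology Z C) f"
proof -
  have eq: "subtopology (prod_topology (subtopology X A) (subtopology Y B)) S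
      = subtopology (subtopology (prod_topology X Y) S) (A \<times> B)"
    by (simp add: subtopology_Times[symmetric] subtopology_subtopology Int_commute)
  show ?thesis
    unfolding eq continuous_map_in_subtopology
    using continuous_map_from_subtopology[OF f] C by (fastforce simp: image_subset_iff)
qed

lemma (in lch_groupoid) unit_simps:
  assumes "u \<in> units G"
  shows "u \<in> arrows G" "rng G u = u" "src G u = u"
  using assms by (auto simp: units_def src_closed rng_src src_src)

lemma (in free_proper_left_space) act_inj:
  assumes g: "g \<in> arrows G" and h: "h \<in> arrows G" and x: "x \<in> topspace X"
    and src: "src G g = mom x" "src G h = mom x" and eq: "act g x = act h x"
  shows "g = h"
proof -
  have rng: "rng G g = rng G h" using mom_act g h x src eq by metis
  have "act (gmul G (ginv G h) g) x = act (gmul G (ginv G h) h) x"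
    using g h x src rng eq by (simp add: act_mul inv_closed src_inv)
  also have "\<dots> = x" using h src x by (simp add: inv_mul act_unit)
  finally have unit: "gmul G (ginv G h) g \<in> units G"
    using g h x src rng by (intro free) (auto simp: mul_closed inv_closed src_inv src_mul)
  then have "gmul G (ginv G h) g = src G h"
    using unit_simps(3)[OF unit] g h src rng by (simp add: src_mul inv_closed src_inv)
  then have "gmul G h (gmul G (ginv G h) g) = h" using h by (simp add: mul_src)
  moreover have "gmul G h (gmul G (ginv G h) g) = g"
    using g h rng rng_mul_self[OF g]
      by (simp add: mul_assoc[symmetric] inv_closed rng_inv src_inv mul_inv)
  ultimately show ?thesis by simp
qed

lemma (in free_proper_right_space) act_inj:
  assumes g: "g \<in> arrows G" and h: "h \<in> arrows G" and x: "x \<in> topspace X"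
    and rng: "mom x = rng G g" "mom x = rng G h" and eq: "act x g = act x h"
  shows "g = h"
proof -
  have src: "src G g = src G h" using mom_act g h x rng eq by metis
  have "act x (gmul G g (ginv G h)) = act x (gmul G h (ginv G h))"
    using g h x rng src eq by (simp add: act_mul inv_closed rng_inv)
  also have "\<dots> = x" using h rng(2) act_unit[OF x] by (simp add: mul_inv)
  finally have unit: "gmul G g (ginv G h) \<in> units G"
    using g h x src rng by (intro free) (auto simp: mul_closed inv_closed rng_inv rng_mul)
  then have "gmul G g (ginv G h) = rng G h"
    using unit_simps(2)[OF unit] g h src rng by (simp add: rng_mul inv_closed rng_inv)
  then have "gmul G (gmul G g (ginv G h)) h = h" using h by (simp add: rng_mul_self)
  moreover have "gmul G (gmul G g (ginv G h)) h = g"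
    using g h src mul_src[OF g] by (simp add: mul_assoc inv_closed rng_inv src_inv inv_mul)
  ultimately show ?thesis by simp
qed

lemma banach_subbundle_lin_span:
  assumes "banach_subbundle X \<B> \<D>" "x \<in> topspace X"
  shows "lin_span (fibre \<B> x) (\<D> \<inter> fib \<B> x) \<subseteq> \<D> \<inter> fib \<B> x"
proof
  fix a assume "a \<in> lin_span (fibre \<B> x) (\<D> \<inter> fib \<B> x)"
  then show "a \<in> \<D> \<inter> fib \<B> x"
    using assms unfolding banach_subbundle_def closed_subspace_def by induction auto
qed

text \<open>Over a unit \<open>u\<close>, the imprimitivity bimodule of the Fell bundle \<open>\<J>\<close> is \<open>J\<^sub>u\<close> with the inner product
  \<open>a\<^sup>* b\<close>. Its fullness is the idempotency of \<open>J\<^sub>u\<close>.\<close>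
lemma fell_ideal_fibre:
  assumes "fell_bundle G \<B>" "fell_ideal G \<B> \<J>" "u \<in> units G"
  shows "cstar_ideal (fibre_alg \<B> u) (\<J> \<inter> fib \<B> u)"
proof -
  interpret B: fell_bundle G \<B> by fact
  interpret J: fell_bundle G "\<B> \<restriction>\<^sub>b \<J>"
    using assms(2) by (simp add: fell_ideal_def fell_subbundle_def)
  note u = B.unit_simps[OF assms(3)]
  interpret Bu: cstar_algebra "fibre_alg \<B> u" by (rule B.fibre_cstar[OF assms(3)])
  interpret Ju: cstar_algebra "fibre_alg \<B> u\<lparr>carr := \<J> \<inter> fib \<B> u\<rparr>"
    using J.fibre_cstar[OF assms(3)] by (simp add: fibre_alg_restrict)
  let ?J = "\<J> \<inter> fib \<B> u" and ?A = "fibre_alg \<B> u\<lparr>carr := \<J> \<inter> fib \<B> u\<rparr>"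
  have ideal: "bmul \<B> a b \<in> \<J>" if "a \<in> fib \<B> u" "b \<in> fib \<B> u" "a \<in> \<J> \<or> b \<in> \<J>" for a b
    using that assms(2) u unfolding fell_ideal_def fib_def by auto
  have full: "norm_topology ?A closure_of
      lin_span ?A {bmul \<B> (bstar \<B> a) b | a b. a \<in> ?J \<and> b \<in> ?J} = ?J"
    using full_right_hilbert_module.ip_full[OF imprimitivity_bimodule.axioms(2)
        [OF J.fibre_imprimitivity[OF u(1)]]]
    by (simp add: fibre_alg_restrict u)
  have sub: "{bmul \<B> (bstar \<B> a) b | a b. a \<in> ?J \<and> b \<in> ?J} \<subseteq> {bmul \<B> a b | a b. a \<in> ?J \<and> b \<in> ?J}"
  proof clarify
    fix a b assume ab: "a \<in> \<J>" "a \<in> fib \<B> u" "b \<in> \<J>" "b \<in> fib \<B> u"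
    then have "bstar \<B> a \<in> ?J" using Ju.star_closed[of a] by simp
    with ab show "\<exists>a' b'. bmul \<B> (bstar \<B> a) b = bmul \<B> a' b' \<and> a' \<in> ?J \<and> b' \<in> ?J" by blast
  qed
  have idem: "?J \<subseteq> norm_topology ?A closure_of lin_span ?A {bmul \<B> a b | a b. a \<in> ?J \<and> b \<in> ?J}"
    by (subst full[symmetric]) (intro closure_of_mono lin_span_mono sub)
  show ?thesis
    by (intro cstar_ideal.intro cstar_ideal_axioms.intro Bu.cstar_algebra_axioms Ju.cstar_algebra_axioms)
      (use ideal idem Bu.mul_closed in auto)
qed

lemma topspace_orbit_topology: "topspace (orbit_topology X orb) = orb ` topspace X"
proof
  have eq: "{x \<in> topspace X. orb x \<in> orb ` topspace X} = topspace X" by blast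
  show "orb ` topspace X \<subseteq> topspace (orbit_topology X orb)"
    by (rule openin_subset) (simp add: openin_orbit_topology eq)
  show "topspace (orbit_topology X orb) \<subseteq> orb ` topspace X"
    using openin_topspace[of "orbit_topology X orb"] unfolding openin_orbit_topology by blast
qed

section \<open>The restricted equivalence\<close>

context fell_equivalence
begin

lemma point_simps:
  assumes "t \<in> points T"
  shows "lmom T t \<in> units H" "rmom T t \<in> units K"
  using assms L.mom_continuous R.mom_continuous by (auto simp: continuous_map_def Pi_iff)

text \<open>The homeomorphism from the space of left orbits to the units of \<open>K\<close> puts points with equal
  right moment into one orbit, so some arrow translates \<open>t'\<close> to \<open>t\<close>. Freeness makes it unique, and
  so the definite description \<open>tauL\<close> denotes it.\<close>
lemma rng_tauL:
  assumes t: "t \<in> points T" and t': "t' \<in> points T" and eq: "rmom T t = rmom T t'"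
  shows "rng H (tauL H T t t') = lmom T t"
proof -
  obtain f where f: "homeomorphic_map (orbit_topology (ttop T) (left_orbit H T)) (subtopology (gtop K) (units K)) f"
    and fm: "\<And>t. t \<in> points T \<Longrightarrow> f (left_orbit H T t) = rmom T t"
    using rmom_homeo by blast
  have "left_orbit H T t = left_orbit H T t'"
  proof (rule inj_onD)
    show "inj_on f (left_orbit H T ` points T)"
      using homeomorphic_imp_injective_map[OF f] by (simp add: topspace_orbit_topology)
  qed (use fm t t' eq in auto)
  moreover have "t \<in> left_orbit H T t"
    using L.unit_simps[OF point_simps(1)[OF t]] L.act_unit[OF t] unfolding left_orbit_def by force
  ultimately have "t \<in> left_orbit H T t'" by simp
  then obtain h where h: "h \<in> arrows H" "src H h = lmom T t'" "tlact T h t' = t"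
    by (auto simp: left_orbit_def)
  have "tauL H T t t' = h"
    unfolding tauL_def using h L.act_inj[OF _ _ t'] by (intro the_equality) auto
  then show ?thesis using L.mom_act[OF h(1) t' h(2)] h(3) by simp
qed

text \<open>The same argument for the right orbits.\<close>
lemma src_tauR:
  assumes t: "t \<in> points T" and t': "t' \<in> points T" and eq: "lmom T t = lmom T t'"
  shows "src K (tauR K T t t') = rmom T t'"
proof -
  obtain f where f: "homeomorphic_map (orbit_topology (ttop T) (right_orbit K T)) (subtopology (gtop H) (units H)) f"
    and fm: "\<And>t. t \<in> points T \<Longrightarrow> f (right_orbit K T t) = lmom T t"
    using lmom_homeo by blast
  have "right_orbit K T t = right_orbit K T t'"
  proof (rule inj_onD)
    show "inj_on f (right_orbit K T ` points T)"
      using homeomorphic_imp_injective_map[OF f] by (simp add: topspace_orbit_topology)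
  qed (use fm t t' eq in auto)
  moreover have "t' \<in> right_orbit K T t'"
    using R.unit_simps[OF point_simps(2)[OF t']] R.act_unit[OF t'] unfolding right_orbit_def by force
  ultimately have "t' \<in> right_orbit K T t" by simp
  then obtain k where k: "k \<in> arrows K" "rmom T t = rng K k" "tract T t k = t'"
    by (auto simp: right_orbit_def)
  have "tauR K T t t' = k"
    unfolding tauR_def using k R.act_inj[OF _ _ t] by (intro the_equality) auto
  then show ?thesis using R.mom_act[OF t k(1,2)] k(3) by simp
qed

lemma fibE_D: "e \<in> fib \<E> t \<Longrightarrow> e \<in> topspace (btop \<E>) \<and> proj \<E> e = t \<and> t \<in> points T"
  using E.proj_continuous by (auto simp: fib_def continuous_map_def Pi_iff)

lemma fibB_D: "b \<in> fib \<B> h \<Longrightarrow> b \<in> topspace (btop \<B>) \<and> proj \<B> b = h \<and> h \<in> arrows H"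
  using B.proj_continuous by (auto simp: fib_def continuous_map_def Pi_iff)

lemma fibC_D: "c \<in> fib \<C> k \<Longrightarrow> c \<in> topspace (btop \<C>) \<and> proj \<C> c = k \<and> k \<in> arrows K"
  using C.proj_continuous by (auto simp: fib_def continuous_map_def Pi_iff)

lemma lip_in_fib:
  assumes "e \<in> fib \<E> t" "f \<in> fib \<E> t'" "rmom T t = rmom T t'"
  shows "lip \<E> e f \<in> fib \<B> (tauL H T t t')"
proof -
  have "lip \<E> e f \<in> topspace (btop \<B>)"
    using continuous_map_image_subset_topspace[OF lip_continuous] assms by (auto simp: fib_def)
  then show ?thesis using proj_lip assms by (auto simp: fib_def)
qed

lemma rip_in_fib:
  assumes "e \<in> fib \<E> t" "f \<in> fib \<E> t'" "lmom T t = lmom T t'"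
  shows "rip \<E> e f \<in> fib \<C> (tauR K T t t')"
proof -
  have "rip \<E> e f \<in> topspace (btop \<C>)"
    using continuous_map_image_subset_topspace[OF rip_continuous] assms by (auto simp: fib_def)
  then show ?thesis using proj_rip assms by (auto simp: fib_def)
qed

lemma lact_unit_in_fib: "\<lbrakk>b \<in> fib \<B> (lmom T t); e \<in> fib \<E> t\<rbrakk> \<Longrightarrow> lact \<E> b e \<in> fib \<E> t"
  using imprimitivity_bimodule.axioms(1)[OF fibre_equiv, THEN full_left_hilbert_module.act_closed] fibE_D
  by fastforce

lemma ract_unit_in_fib: "\<lbrakk>e \<in> fib \<E> t; c \<in> fib \<C> (rmom T t)\<rbrakk> \<Longrightarrow> ract \<E> e c \<in> fib \<E> t"
  using imprimitivity_bimodule.axioms(2)[OF fibre_equiv, THEN full_right_hilbert_module.act_closed] fibE_D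
  by fastforce

text \<open>On generators \<open>\<langle>k e, f\<rangle> = k \<langle>e, f\<rangle>\<close>, and \<open>\<K>\<close> absorbs products. The general case follows because
  \<open>\<langle>\<cdot>, f\<rangle>\<close> maps the fibre \<open>E\<^sub>t\<close> linearly into a single fibre of \<open>\<B>\<close>, in which \<open>\<K>\<close> is a subspace.\<close>
lemma lip_ideal_times_module:
  assumes K: "fell_ideal H \<B> \<K>" and e: "e \<in> ideal_times_module T \<B> \<E> \<K>"
    and f: "f \<in> topspace (btop \<E>)" and ef: "rmom T (proj \<E> e) = rmom T (proj \<E> f)"
  shows "lip \<E> e f \<in> \<K>"
proof -
  from e obtain t where t: "t \<in> points T"
    and et: "e \<in> lin_span (fibre \<E> t) {lact \<E> b e | b e. b \<in> \<K> \<inter> fib \<B> (lmom T t) \<and> e \<in> fib \<E> t}"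
      (is "_ \<in> lin_span _ ?G")
    by (auto simp: ideal_times_module_def lprod_def)
  interpret Et: complex_banach "fibre \<E> t" by (rule E.fibre_banach[OF t])
  have G: "?G \<subseteq> carr (fibre \<E> t)" using lact_unit_in_fib by auto
  have eE: "e \<in> fib \<E> t" using Et.lin_span_closed[OF G] et by auto
  define t' where "t' = proj \<E> f"
  have f': "f \<in> fib \<E> t'" using f by (simp add: t'_def fib_def)
  have rm: "rmom T t = rmom T t'" using ef eE by (simp add: t'_def fib_def)
  let ?h = "tauL H T t t'"
  have h: "?h \<in> arrows H" using fibB_D[OF lip_in_fib[OF eE f' rm]] by blast
  have "lip \<E> e f \<in> lin_span (fibre \<B> ?h) ((\<lambda>e. lip \<E> e f) ` ?G)"
    using lip_add_left lip_sc_left fibE_D f' rm t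
    by (intro lin_span_image[OF E.fibre_banach[OF t] B.fibre_banach[OF h] _ _ _ G et])
      (auto intro: lip_in_fib)
  moreover have "(\<lambda>e. lip \<E> e f) ` ?G \<subseteq> \<K> \<inter> fib \<B> ?h"
  proof
    fix y assume "y \<in> (\<lambda>e. lip \<E> e f) ` ?G"
    then obtain b x where b: "b \<in> \<K>" "b \<in> fib \<B> (lmom T t)" and x: "x \<in> fib \<E> t"
      and y: "y = lip \<E> (lact \<E> b x) f" by auto
    note u = L.unit_simps[OF point_simps(1)[OF t]]
    have yb: "y = bmul \<B> b (lip \<E> x f)"
      using b x f' rm u unfolding y by (intro lip_lact) (auto simp: fib_def)
    have y_fib: "y \<in> fib \<B> ?h" unfolding y by (intro lip_in_fib lact_unit_in_fib b x f' rm)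
    have xf: "lip \<E> x f \<in> fib \<B> ?h" by (rule lip_in_fib[OF x f' rm])
    have "rng H ?h = lmom T t" using rng_tauL[OF t _ rm] fibE_D[OF f'] by blast
    then have "y \<in> \<K>"
      using K b u fibB_D[OF xf] unfolding yb fell_ideal_def by (auto simp: fib_def)
    with y_fib show "y \<in> \<K> \<inter> fib \<B> ?h" by blast
  qed
  ultimately have "lip \<E> e f \<in> lin_span (fibre \<B> ?h) (\<K> \<inter> fib \<B> ?h)"
    by (rule subsetD[OF lin_span_mono, rotated])
  moreover have "lin_span (fibre \<B> ?h) (\<K> \<inter> fib \<B> ?h) \<subseteq> \<K> \<inter> fib \<B> ?h"
    using K h by (intro banach_subbundle_lin_span) (auto simp: fell_ideal_def fell_subbundle_def)
  ultimately show ?thesis by blast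
qed

text \<open>Symmetrically, \<open>\<langle>e, f c\<rangle> = \<langle>e, f\<rangle> c\<close>.\<close>
lemma rip_module_times_ideal:
  assumes J: "fell_ideal K \<C> \<J>" and f: "f \<in> module_times_ideal T \<C> \<E> \<J>"
    and e: "e \<in> topspace (btop \<E>)" and ef: "lmom T (proj \<E> e) = lmom T (proj \<E> f)"
  shows "rip \<E> e f \<in> \<J>"
proof -
  from f obtain t' where t': "t' \<in> points T"
    and ft: "f \<in> lin_span (fibre \<E> t') {ract \<E> e c | e c. e \<in> fib \<E> t' \<and> c \<in> \<J> \<inter> fib \<C> (rmom T t')}"
      (is "_ \<in> lin_span _ ?G")
    by (auto simp: module_times_ideal_def rprod_def)
  interpret Et: complex_banach "fibre \<E> t'" by (rule E.fibre_banach[OF t'])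
  have G: "?G \<subseteq> carr (fibre \<E> t')" using ract_unit_in_fib by auto
  have fE: "f \<in> fib \<E> t'" using Et.lin_span_closed[OF G] ft by auto
  define t where "t = proj \<E> e"
  have e': "e \<in> fib \<E> t" using e by (simp add: t_def fib_def)
  have t: "t \<in> points T" using fibE_D[OF e'] by blast
  have lm: "lmom T t = lmom T t'" using ef fE by (simp add: t_def fib_def)
  let ?k = "tauR K T t t'"
  have k: "?k \<in> arrows K" using fibC_D[OF rip_in_fib[OF e' fE lm]] by blast
  have "rip \<E> e f \<in> lin_span (fibre \<C> ?k) ((\<lambda>f. rip \<E> e f) ` ?G)"
    using rip_add_right rip_sc_right e' lm t t'
    by (intro lin_span_image[OF E.fibre_banach[OF t'] C.fibre_banach[OF k] _ _ _ G ft])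
      (auto intro: rip_in_fib)
  moreover have "(\<lambda>f. rip \<E> e f) ` ?G \<subseteq> \<J> \<inter> fib \<C> ?k"
  proof
    fix y assume "y \<in> (\<lambda>f. rip \<E> e f) ` ?G"
    then obtain c x where c: "c \<in> \<J>" "c \<in> fib \<C> (rmom T t')" and x: "x \<in> fib \<E> t'"
      and y: "y = rip \<E> e (ract \<E> x c)" by auto
    note u = R.unit_simps[OF point_simps(2)[OF t']]
    have yc: "y = bmul \<C> (rip \<E> e x) c"
      using c x e' lm u unfolding y by (intro rip_ract) (auto simp: fib_def)
    have y_fib: "y \<in> fib \<C> ?k" unfolding y by (intro rip_in_fib ract_unit_in_fib c x e' lm)
    have ex: "rip \<E> e x \<in> fib \<C> ?k" by (rule rip_in_fib[OF e' x lm])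
    have "y \<in> \<J>"
      using J c u fibC_D[OF ex] src_tauR[OF t t' lm] unfolding yc fell_ideal_def by (auto simp: fib_def)
    with y_fib show "y \<in> \<J> \<inter> fib \<C> ?k" by blast
  qed
  ultimately have "rip \<E> e f \<in> lin_span (fibre \<C> ?k) (\<J> \<inter> fib \<C> ?k)"
    by (rule subsetD[OF lin_span_mono, rotated])
  moreover have "lin_span (fibre \<C> ?k) (\<J> \<inter> fib \<C> ?k) \<subseteq> \<J> \<inter> fib \<C> ?k"
    using J k by (intro banach_subbundle_lin_span) (auto simp: fell_ideal_def fell_subbundle_def)
  ultimately show ?thesis by blast
qed

text \<open>The two descriptions of \<open>\<M>\<close> serve two purposes each: \<open>\<M> = \<K> \<cdot> \<E>\<close> gives \<open>K\<^sub>u E\<^sub>t \<subseteq> M\<^sub>t\<close> for \<open>u = \<rho>(t)\<close>, on which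
  fullness depends, as well as the position of the left inner product; likewise \<open>\<M> = \<E> \<cdot> \<J>\<close> on the
  right.\<close>
lemma fibre_equiv_restrict:
  assumes K: "fell_ideal H \<B> \<K>" and J: "fell_ideal K \<C> \<J>" and M: "banach_subbundle (ttop T) \<E> \<M>"
    and MJ: "\<M> = module_times_ideal T \<C> \<E> \<J>" and KM: "\<M> = ideal_times_module T \<B> \<E> \<K>"
    and t: "t \<in> points T"
  shows "imprimitivity_bimodule (fibre_alg (\<B> \<restriction>\<^sub>b \<K>) (lmom T t)) (fibre_alg (\<C> \<restriction>\<^sub>b \<J>) (rmom T t))
           (fibre (\<E> \<restriction>\<^sub>b \<M>) t) (lact \<E>) (ract \<E>) (lip \<E>) (rip \<E>)"
  unfolding fibre_restrict fibre_alg_restrict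
proof (rule imprimitivity_bimodule_restrict[OF fibre_equiv[OF t]])
  note left = imprimitivity_bimodule.axioms(1)[OF fibre_equiv[OF t]]
    and right = imprimitivity_bimodule.axioms(2)[OF fibre_equiv[OF t]]
  show "cstar_ideal (fibre_alg \<B> (lmom T t)) (\<K> \<inter> fib \<B> (lmom T t))"
    by (rule fell_ideal_fibre[OF B.fell_bundle_axioms K point_simps(1)[OF t]])
  show "cstar_ideal (fibre_alg \<C> (rmom T t)) (\<J> \<inter> fib \<C> (rmom T t))"
    by (rule fell_ideal_fibre[OF C.fell_bundle_axioms J point_simps(2)[OF t]])
  show "complex_banach (fibre \<E> t\<lparr>carr := \<M> \<inter> fib \<E> t\<rparr>)"
  proof -
    have "banach_bundle (ttop T) (\<E> \<restriction>\<^sub>b \<M>)" using M by (simp add: banach_subbundle_def)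
    from banach_bundle.fibre_banach[OF this t] show ?thesis by (simp only: fibre_restrict)
  qed
  show "\<M> \<inter> fib \<E> t \<subseteq> carr (fibre \<E> t)" by simp
  show "lact \<E> a x \<in> \<M> \<inter> fib \<E> t" if "a \<in> \<K> \<inter> fib \<B> (lmom T t)" "x \<in> carr (fibre \<E> t)" for a x
  proof
    show "lact \<E> a x \<in> fib \<E> t" using that lact_unit_in_fib by simp
    show "lact \<E> a x \<in> \<M>"
      unfolding KM ideal_times_module_def lprod_def using that t by (auto intro!: lin_span.base)
  qed
  show "ract \<E> x c \<in> \<M> \<inter> fib \<E> t" if "x \<in> carr (fibre \<E> t)" "c \<in> \<J> \<inter> fib \<C> (rmom T t)" for c x
  proof
    show "ract \<E> x c \<in> fib \<E> t" using that ract_unit_in_fib by simp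
    show "ract \<E> x c \<in> \<M>"
      unfolding MJ module_times_ideal_def rprod_def using that t by (auto intro!: lin_span.base)
  qed
  fix x y assume xy: "x \<in> \<M> \<inter> fib \<E> t" "y \<in> \<M> \<inter> fib \<E> t"
  show "lip \<E> x y \<in> \<K> \<inter> fib \<B> (lmom T t)"
  proof
    show "lip \<E> x y \<in> fib \<B> (lmom T t)" using xy full_left_hilbert_module.ip_closed[OF left] by simp
    show "lip \<E> x y \<in> \<K>"
      using xy by (intro lip_ideal_times_module[OF K]) (auto simp: KM[symmetric] fib_def)
  qed
  show "rip \<E> x y \<in> \<J> \<inter> fib \<C> (rmom T t)"
  proof
    show "rip \<E> x y \<in> fib \<C> (rmom T t)" using xy full_right_hilbert_module.ip_closed[OF right] by simp
    show "rip \<E> x y \<in> \<J>"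
      using xy by (intro rip_module_times_ideal[OF J]) (auto simp: MJ[symmetric] fib_def)
  qed
qed

end

theorem proposition4p1:
  fixes H :: "'h groupoid_data" and K :: "'k groupoid_data"
    and T :: "('t, 'h, 'k) equivalence_data"
    and \<B> :: "('b, 'h) fell_data" and \<C> :: "('c, 'k) fell_data"
    and \<E> :: "('e, 't, 'b, 'c) fell_equiv_data"
    and \<J> :: "'c set" and \<M> :: "'e set" and \<K> :: "'b set"
  assumes "fell_equivalence H K T \<B> \<C> \<E>"
    and "fell_ideal K \<C> \<J>"
    and "full_banach_submodule H K T \<B> \<C> \<E> \<M>"
    and "\<M> = module_times_ideal T \<C> \<E> \<J>"
    and "fell_ideal H \<B> \<K>"
    and "ideal_times_module T \<B> \<E> \<K> = \<M>"
  shows "fell_equivalence H K T (\<B> \<restriction>\<^sub>b \<K>) (\<C> \<restriction>\<^sub>b \<J>) (\<E> \<restriction>\<^sub>b \<M>)"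
proof -
  interpret fell_equivalence H K T \<B> \<C> \<E> by fact
  have M: "banach_subbundle (ttop T) \<E> \<M>"
    using assms(3) by (simp add: full_banach_submodule_def banach_submodule_def)
  have K: "fell_subbundle H \<B> \<K>" and J: "fell_subbundle K \<C> \<J>"
    using assms(2,5) by (simp_all add: fell_ideal_def)
  have in_fib: "x \<in> fib \<E> (proj \<E> x)" "proj \<E> x \<in> points T" if "x \<in> topspace (btop \<E>)" for x
    using that fibE_D[of x "proj \<E> x"] by (auto simp: fib_def)
  have lact_M: "lact \<E> b x \<in> \<M>"
    if "b \<in> topspace (btop \<B>)" "x \<in> topspace (btop \<E>)" "x \<in> \<M>" "src H (proj \<B> b) = lmom T (proj \<E> x)" for b x
  proof -
    have b: "b \<in> fib \<B> (proj \<B> b)" using that by (simp add: fib_def)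
    have "lprod \<E> (tlact T (proj \<B> b) (proj \<E> x)) (fib \<B> (proj \<B> b)) (\<M> \<inter> fib \<E> (proj \<E> x)) \<subseteq> \<M>"
      using assms(3) fibB_D[OF b] in_fib that
      unfolding full_banach_submodule_def banach_submodule_def by blast
    moreover have "lact \<E> b x \<in> lprod \<E> (tlact T (proj \<B> b) (proj \<E> x)) (fib \<B> (proj \<B> b)) (\<M> \<inter> fib \<E> (proj \<E> x))"
      unfolding lprod_def using b in_fib that by (intro lin_span.base) blast
    ultimately show ?thesis by blast
  qed
  have ract_M: "ract \<E> x c \<in> \<M>"
    if "c \<in> topspace (btop \<C>)" "x \<in> topspace (btop \<E>)" "x \<in> \<M>" "rmom T (proj \<E> x) = rng K (proj \<C> c)" for c x
  proof -
    have c: "c \<in> fib \<C> (proj \<C> c)" using that by (simp add: fib_def)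
    have "rprod \<E> (tract T (proj \<E> x) (proj \<C> c)) (\<M> \<inter> fib \<E> (proj \<E> x)) (fib \<C> (proj \<C> c)) \<subseteq> \<M>"
      using assms(3) fibC_D[OF c] in_fib that
      unfolding full_banach_submodule_def banach_submodule_def by blast
    moreover have "ract \<E> x c \<in> rprod \<E> (tract T (proj \<E> x) (proj \<C> c)) (\<M> \<inter> fib \<E> (proj \<E> x)) (fib \<C> (proj \<C> c))"
      unfolding rprod_def using c in_fib that by (intro lin_span.base) blast
    ultimately show ?thesis by blast
  qed
  have lip_K: "lip \<E> e f \<in> \<K>"
    if "e \<in> \<M>" "f \<in> topspace (btop \<E>)" "rmom T (proj \<E> e) = rmom T (proj \<E> f)" for e f
    by (rule lip_ideal_times_module[OF assms(5)]) (use that assms(6) in auto)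
  have rip_J: "rip \<E> e f \<in> \<J>"
    if "f \<in> \<M>" "e \<in> topspace (btop \<E>)" "lmom T (proj \<E> e) = lmom T (proj \<E> f)" for e f
    by (rule rip_module_times_ideal[OF assms(2)]) (use that assms(4) in auto)
  have left: "fell_left_action H T (\<B> \<restriction>\<^sub>b \<K>) (\<E> \<restriction>\<^sub>b \<M>)"
    unfolding fell_left_action_def restrict_bundle_simps restrict_fell_simps restrict_equiv_simps
    by (intro conjI continuous_map_restrict_pairs lact_continuous)
      (auto simp: lact_M proj_lact lact_assoc lact_norm)
  have right: "fell_right_action K T (\<C> \<restriction>\<^sub>b \<J>) (\<E> \<restriction>\<^sub>b \<M>)"
    unfolding fell_right_action_def restrict_bundle_simps restrict_fell_simps restrict_equiv_simps
    by (intro conjI continuous_map_restrict_pairs ract_continuous)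
      (auto simp: ract_M proj_ract ract_assoc ract_norm)
  have lip_cont: "continuous_map
      (subtopology (prod_topology (subtopology (btop \<E>) \<M>) (subtopology (btop \<E>) \<M>))
        {(e, f). rmom T (proj \<E> e) = rmom T (proj \<E> f)})
      (subtopology (btop \<B>) \<K>) (\<lambda>(e, f). lip \<E> e f)"
    by (rule continuous_map_restrict_pairs[OF lip_continuous]) (auto simp: lip_K)
  have rip_cont: "continuous_map
      (subtopology (prod_topology (subtopology (btop \<E>) \<M>) (subtopology (btop \<E>) \<M>))
        {(e, f). lmom T (proj \<E> e) = lmom T (proj \<E> f)})
      (subtopology (btop \<C>) \<J>) (\<lambda>(e, f). rip \<E> e f)"
    by (rule continuous_map_restrict_pairs[OF rip_continuous]) (auto simp: rip_J)
  note fibres = fibre_equiv_restrict[OF assms(5,2) M assms(4) assms(6)[symmetric]]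
  show ?thesis
  proof (intro fell_equivalence.intro left right groupoid_equivalence_axioms)
    show "fell_bundle H (\<B> \<restriction>\<^sub>b \<K>)" "fell_bundle K (\<C> \<restriction>\<^sub>b \<J>)" "banach_bundle (ttop T) (\<E> \<restriction>\<^sub>b \<M>)"
      using K J M by (simp_all add: fell_subbundle_def banach_subbundle_def)
    show "fell_equivalence_axioms H K T (\<B> \<restriction>\<^sub>b \<K>) (\<C> \<restriction>\<^sub>b \<J>) (\<E> \<restriction>\<^sub>b \<M>)"
      unfolding fell_equivalence_axioms_def restrict_bundle_simps restrict_fell_simps
        restrict_equiv_simps fib_restrict topspace_subtopology Int_iff
      by (intro conjI allI impI lip_cont rip_cont fibres;
          (elim conjE)?; simp add: lact_ract lip_add_left lip_add_right lip_sc_left lip_sc_right rip_add_left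
            rip_add_right rip_sc_left rip_sc_right proj_lip proj_rip lip_star rip_star lip_lact rip_ract lip_rip)
  qed
qed

end
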